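(* Let $X$ be a connected complex manifold, let $f:X\to X$ be holomorphic, let $u\in\mathcal{O}(X)$, and let $V\subset\mathcal{O}(X)$ be a complex topological vector space with continuous inclusion. Assume that $uC_f$ is supercyclic on $V$ and $\dim V\ge2$ (resp. $uC_f$ is hypercyclic on $V$ and $\dim V\ge1$). Then $f$ has no periodic points.
   Context: $\mathcal{O}(X)$ is the space of holomorphic functions on $X$ with the topology of uniform convergence on compact sets. "$V\subset\mathcal{O}(X)$ with continuous inclusion" means $V$ is a complex linear subspace of $\mathcal{O}(X)$ equipped with its own vector space topology such that the inclusion $V\hookrightarrow\mathcal{O}(X)$ is continuous. The weighted composition operator $uC_f$ on $V$ is $h\mapsto u\cdot(h\circ f)$ with domain $D(uC_f)=\{h\in V:u\cdot(h\circ f)\in V\}$. For a topological vector space $W$ and a densely defined linear operator $S$ on $W$ with domain $D(S)$, put $D(S^0):=W$, $D(S^{n+1}):=\{x\in D(S^n):S^nx\in D(S)\}$ for $n\ge0$, and $D_\infty(S):=\bigcap_{n\ge0}D(S^n)$. $S$ is hypercyclic if there is $x\in D_\infty(S)$ such that $\{S^nx:n\ge0\}$ is dense in $W$; $S$ is supercyclic if there is $x\in D_\infty(S)$ such that $\{\lambda S^nx:\lambda\in\mathbb{C},\,n\ge0\}$ is dense in $W$. In particular, calling $uC_f$ supercyclic or hypercyclic includes that $D(uC_f)$ is dense in $V$. A periodic point of $f$ is a point $p\in X$ with $f^r(p)=p$ for some $r\ge1$, where $f^r$ is the $r$-th iterate. *)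

theory Defs
  imports "HOL-Analysis.Analysis" "HOL-Library.Function_Algebras"
begin

section \<open>Complex manifolds\<close>

text \<open>
  Complex differentiability in several variables, with the vector \<open>c\<close> of complex
  partial derivatives. It is used for sets \<open>A\<close> that are relatively open in a complex linear
  subspace \<open>E\<close> of the ambient coordinate space; then the derivative within \<open>A\<close> is the
  derivative along \<open>E\<close>, and every complex linear form on \<open>E\<close> is given by some \<open>c\<close>.
\<close>

definition mv_holomorphic_on :: "(complex ^ 'n \<Rightarrow> complex) \<Rightarrow> (complex ^ 'n) set \<Rightarrow> bool"
  where "mv_holomorphic_on h A \<longleftrightarrow>
    (\<forall>z\<in>A. \<exists>c :: complex ^ 'n.
       (h has_derivative (\<lambda>v. \<Sum>i\<in>UNIV. c $ i * v $ i)) (at z within A))"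

type_synonym ('a, 'n) chart = "'a set \<times> ('a \<Rightarrow> complex ^ 'n)"

text \<open>
  A holomorphic atlas on the whole type, modelled on a finite-dimensional complex vector space
  \<open>E\<close>. Taking \<open>E\<close> to be a linear subspace of a coordinate space (\<open>E = UNIV\<close> being the usual
  case) rather than the coordinate space itself is needed to include manifolds of dimension 0
  (\<open>E = {0}\<close>), because the index type \<open>'n\<close> is never empty. The Hausdorff property and second
  countability are class constraints.
\<close>

definition complex_manifold ::
  "(complex ^ 'n) set \<Rightarrow> ('a :: {t2_space, second_countable_topology}, 'n :: finite) chart set \<Rightarrow> bool"
  where "complex_manifold E \<A> \<longleftrightarrow>
    vec.subspace E \<and>
    (\<Union>(U, \<phi>)\<in>\<A>. U) = UNIV \<and>
    (\<forall>(U, \<phi>)\<in>\<A>. open U \<and> openin (top_of_set E) (\<phi> ` U) \<and>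
       homeomorphism U (\<phi> ` U) \<phi> (inv_into U \<phi>)) \<and>
    (\<forall>(U, \<phi>)\<in>\<A>. \<forall>(W, \<psi>)\<in>\<A>. \<forall>i.
       mv_holomorphic_on (\<lambda>z. \<psi> (inv_into U \<phi> z) $ i) (\<phi> ` (U \<inter> W)))"

definition holomorphic_functions ::
  "('a :: topological_space, 'n :: finite) chart set \<Rightarrow> ('a \<Rightarrow> complex) set"
  where "holomorphic_functions \<A> =
    {h. \<forall>(U, \<phi>)\<in>\<A>. mv_holomorphic_on (\<lambda>z. h (inv_into U \<phi> z)) (\<phi> ` U)}"

definition holomorphic_self_map ::
  "('a :: topological_space, 'n :: finite) chart set \<Rightarrow> ('a \<Rightarrow> 'a) \<Rightarrow> bool"
  where "holomorphic_self_map \<A> f \<longleftrightarrow>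
    continuous_on UNIV f \<and>
    (\<forall>(U, \<phi>)\<in>\<A>. \<forall>(W, \<psi>)\<in>\<A>. \<forall>i.
       mv_holomorphic_on (\<lambda>z. \<psi> (f (inv_into U \<phi> z)) $ i) (\<phi> ` (U \<inter> f -` W)))"

text \<open>
  The topology of uniform convergence on compact sets. The generating sets are open (and form a
  base) because holomorphic functions are continuous, so that a strict pointwise bound on a
  compact set is a strict bound on the maximum.
\<close>

definition compact_convergence_topology ::
  "('a :: topological_space, 'n :: finite) chart set \<Rightarrow> ('a \<Rightarrow> complex) topology"
  where "compact_convergence_topology \<A> =
    topology_generated_by
      {{g \<in> holomorphic_functions \<A>. \<forall>x\<in>K. dist (g x) (h x) < e} | h K e.
         h \<in> holomorphic_functions \<A> \<and> compact K \<and> 0 < e}"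

section \<open>Topological vector spaces of functions\<close>

definition scale_fun :: "complex \<Rightarrow> ('a \<Rightarrow> complex) \<Rightarrow> 'a \<Rightarrow> complex"
  where "scale_fun c h = (\<lambda>x. c * h x)"

global_interpretation fun_vs: vector_space scale_fun
  by unfold_locales (auto simp: scale_fun_def fun_eq_iff algebra_simps)

text \<open>The vector space is the underlying set \<open>topspace T\<close>.\<close>

definition function_tvs :: "('a \<Rightarrow> complex) topology \<Rightarrow> bool"
  where "function_tvs T \<longleftrightarrow>
    fun_vs.subspace (topspace T) \<and>
    continuous_map (prod_topology T T) T (\<lambda>(g, h). g + h) \<and>
    continuous_map (prod_topology euclidean T) T (\<lambda>(c, h). scale_fun c h)"

text \<open>
  The library's \<open>dim\<close> is 0 for infinite-dimensional spaces, whereas here these must satisfy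
  every lower bound.
\<close>

definition dim_at_least :: "nat \<Rightarrow> ('a \<Rightarrow> complex) set \<Rightarrow> bool"
  where "dim_at_least k V \<longleftrightarrow> (\<exists>B\<subseteq>V. fun_vs.independent B \<and> finite B \<and> card B = k)"

section \<open>Hypercyclic and supercyclic operators\<close>

text \<open>
  An operator on \<open>topspace T\<close> is a total function \<open>S\<close> together with its domain \<open>D\<close>; the values of
  \<open>S\<close> outside \<open>D\<close> are irrelevant.
\<close>

primrec power_domain :: "'b topology \<Rightarrow> 'b set \<Rightarrow> ('b \<Rightarrow> 'b) \<Rightarrow> nat \<Rightarrow> 'b set"
  where
    "power_domain T D S 0 = topspace T"
  | "power_domain T D S (Suc n) = {x \<in> power_domain T D S n. (S ^^ n) x \<in> D}"

definition dense_in :: "'b topology \<Rightarrow> 'b set \<Rightarrow> bool"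
  where "dense_in T A \<longleftrightarrow> A \<subseteq> topspace T \<and> T closure_of A = topspace T"

definition hypercyclic :: "'b topology \<Rightarrow> 'b set \<Rightarrow> ('b \<Rightarrow> 'b) \<Rightarrow> bool"
  where "hypercyclic T D S \<longleftrightarrow> dense_in T D \<and>
    (\<exists>x \<in> (\<Inter>n. power_domain T D S n). dense_in T {(S ^^ n) x | n. True})"

definition supercyclic ::
  "(complex \<Rightarrow> 'b \<Rightarrow> 'b) \<Rightarrow> 'b topology \<Rightarrow> 'b set \<Rightarrow> ('b \<Rightarrow> 'b) \<Rightarrow> bool"
  where "supercyclic sc T D S \<longleftrightarrow> dense_in T D \<and>
    (\<exists>x \<in> (\<Inter>n. power_domain T D S n). dense_in T {sc c ((S ^^ n) x) | c n. True})"

section \<open>Weighted composition operators and periodic points\<close>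

definition weighted_comp :: "('a \<Rightarrow> complex) \<Rightarrow> ('a \<Rightarrow> 'a) \<Rightarrow> ('a \<Rightarrow> complex) \<Rightarrow> 'a \<Rightarrow> complex"
  where "weighted_comp u f h = (\<lambda>x. u x * h (f x))"

definition weighted_comp_domain ::
  "('a \<Rightarrow> complex) \<Rightarrow> ('a \<Rightarrow> 'a) \<Rightarrow> ('a \<Rightarrow> complex) set \<Rightarrow> ('a \<Rightarrow> complex) set"
  where "weighted_comp_domain u f V = {h \<in> V. weighted_comp u f h \<in> V}"

definition periodic_point :: "('a \<Rightarrow> 'a) \<Rightarrow> 'a \<Rightarrow> bool"
  where "periodic_point f p \<longleftrightarrow> (\<exists>r\<ge>1. (f ^^ r) p = p)"

end

theory Submission
  imports Defs "HOL-Complex_Analysis.Complex_Analysis"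
    "HOL-Computational_Algebra.Fundamental_Theorem_Algebra"
begin

text \<open>
  Let \<open>S\<close> be the weighted composition operator and suppose that \<open>f\<close> has a periodic point \<open>p\<close>. Its cycle
  \<open>Q\<close> is a finite set that \<open>f\<close> maps to itself. The functions that vanish at every point of \<open>Q\<close> to order
  \<open>m\<close>, in the sense that they are \<open>O(norm (\<phi> x - \<phi> q) ^ m)\<close> in a chart \<open>\<phi>\<close> at \<open>q\<close>, form a subspace \<open>W m\<close>. It
  is invariant under \<open>S\<close>, since \<open>f\<close> is Lipschitz in charts at each \<open>q\<close> and \<open>u\<close> is locally bounded
  (\<open>vanishes_to_order_weighted_comp\<close>).

  Modulo \<open>W m\<close> everything is finite-dimensional: iterated Taylor coefficients, written as Cauchy
  integrals over a polydisc, are finitely many functionals that are continuous for uniform convergence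
  on compact sets and whose common kernel is contained in \<open>W m\<close> (\<open>vanishing_order_finitely_determined\<close>).
  By continuity of the inclusion, density in \<open>V\<close> implies density in terms of their values
  (\<open>dense_in_imp_weakly_dense\<close>). So \<open>S\<close> would induce a hypercyclic or supercyclic operator on a
  finite-dimensional complex space, which is impossible in dimension at least 1 or 2, respectively.
  Hence \<open>V\<close> is contained in \<open>W m\<close> in the hypercyclic case, and in the line through the supercyclic
  vector \<open>x\<close> plus \<open>W m\<close> in the supercyclic case.

  The impossibility (\<open>weakly_hypercyclic_imp_subset\<close>, \<open>weakly_supercyclic_imp_subset\<close>) is shown with
  polynomials in \<open>S\<close> applied to the cyclic vector \<open>x\<close>. Those \<open>g\<close> for which \<open>g(S) x\<close> lies in the invariant
  subspace form an ideal. If the ideal is contained in the one generated by \<open>X - a\<close>, evaluation at \<open>a\<close>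
  sends the orbit to the powers of \<open>a\<close>; if it is contained in the one generated by
  \<open>(X - a) * (X - b)\<close>, evaluation at both roots, or evaluation and derivative at a double root, sends
  the orbit to an explicit orbit of a two-by-two matrix. Neither gives a dense set, so the ideal has
  codimension 0, respectively at most 1.

  Finally \<open>m\<close> tends to infinity. By the identity theorem on the connected manifold (\<open>flat_imp_zero\<close>), the
  intersection of all \<open>W m\<close> contains no holomorphic function except 0. So \<open>V\<close> is zero in the
  hypercyclic case and at most a line in the supercyclic case, against the assumption on its dimension.
\<close>

section \<open>Finitely many linear functionals\<close>

text \<open>
  Induction on the number of functionals: either the last one already vanishes on the common kernel
  of the others, or some \<open>y0\<close> in that kernel detects it, and subtracting the right multiple of the
  last functional from \<open>e\<close> makes \<open>e\<close> vanish at \<open>y0\<close> too.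
\<close>

lemma functional_vanishing_on_common_kernel:
  fixes s :: "'k::field \<Rightarrow> 'b::ab_group_add \<Rightarrow> 'b" and \<phi> :: "'i \<Rightarrow> 'b \<Rightarrow> 'k"
  assumes "finite I" "\<And>i. i \<in> I \<Longrightarrow> Vector_Spaces.linear s (*) (\<phi> i)"
    and "Vector_Spaces.linear s (*) e"
    and "\<And>y. (\<And>i. i \<in> I \<Longrightarrow> \<phi> i y = 0) \<Longrightarrow> e y = 0"
  shows "\<exists>c. \<forall>y. e y = (\<Sum>i\<in>I. c i * \<phi> i y)"
  using assms
proof (induction I arbitrary: e rule: finite_induct)
  case empty
  then show ?case by simp
next
  case (insert j I)
  note lin = insert.prems(1) insert.prems(2)
  show ?case
  proof (cases "\<forall>y. (\<forall>i\<in>I. \<phi> i y = 0) \<longrightarrow> \<phi> j y = 0")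
    case True
    have "\<exists>c. \<forall>y. e y = (\<Sum>i\<in>I. c i * \<phi> i y)"
    proof (rule insert.IH)
      fix y assume "\<And>i. i \<in> I \<Longrightarrow> \<phi> i y = 0"
      then show "e y = 0" by (intro insert.prems(3)) (use True in blast)
    qed (use lin in auto)
    then obtain c where c: "\<And>y. e y = (\<Sum>i\<in>I. c i * \<phi> i y)" by blast
    have "e y = (\<Sum>i\<in>insert j I. (c(j := 0)) i * \<phi> i y)" for y
      using insert.hyps by (auto simp: c intro!: sum.cong)
    then show ?thesis by blast
  next
    case False
    then obtain y0 where y0: "\<And>i. i \<in> I \<Longrightarrow> \<phi> i y0 = 0" "\<phi> j y0 \<noteq> 0" by blast
    define a where "a = e y0 / \<phi> j y0"
    define e' where "e' y = e y - a * \<phi> j y" for y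
    have lin': "Vector_Spaces.linear s (*) e'"
      using lin(1)[of j] lin(2) by (simp add: Vector_Spaces.linear_iff e'_def algebra_simps)
    have "\<exists>c. \<forall>y. e' y = (\<Sum>i\<in>I. c i * \<phi> i y)"
    proof (rule insert.IH)
      fix y assume y: "\<And>i. i \<in> I \<Longrightarrow> \<phi> i y = 0"
      define b where "b = - \<phi> j y / \<phi> j y0"
      have *: "\<phi> i (y + s b y0) = \<phi> i y + b * \<phi> i y0" if "i \<in> insert j I" for i
        using lin(1)[OF that] by (simp add: Vector_Spaces.linear_iff)
      have "e (y + s b y0) = 0"
        by (rule insert.prems(3)) (use y y0 * in \<open>auto simp: b_def\<close>)
      moreover have "e (y + s b y0) = e y + b * e y0"
        using lin(2) by (simp add: Vector_Spaces.linear_iff)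
      ultimately show "e' y = 0"
        by (simp add: e'_def a_def b_def mult.commute)
    qed (use insert.prems lin' in auto)
    then obtain c where c: "\<And>y. e' y = (\<Sum>i\<in>I. c i * \<phi> i y)" by blast
    have "e y = (\<Sum>i\<in>insert j I. (c(j := a)) i * \<phi> i y)" for y
    proof -
      have "(\<Sum>i\<in>I. (c(j := a)) i * \<phi> i y) = (\<Sum>i\<in>I. c i * \<phi> i y)"
        using insert.hyps by (intro sum.cong) auto
      then show ?thesis
        using insert.hyps c[of y] by (simp add: e'_def algebra_simps)
    qed
    then show ?thesis by blast
  qed
qed

lemma norm_linear_combination_less:
  fixes c :: "'i \<Rightarrow> complex"
  assumes "finite I" "0 < \<epsilon>"
  obtains \<delta> where "0 < \<delta>"
    "\<And>t u. (\<And>i. i \<in> I \<Longrightarrow> norm (t i - u i) < \<delta>) \<Longrightarrow>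
      norm ((\<Sum>i\<in>I. c i * t i) - (\<Sum>i\<in>I. c i * u i)) < (\<epsilon>::real)"
proof -
  \<comment> \<open>The summand 1 keeps the divisor positive when all coefficients vanish.\<close>
  define S where "S = 1 + (\<Sum>i\<in>I. norm (c i))"
  have S: "1 \<le> S" by (simp add: S_def sum_nonneg)
  have "norm ((\<Sum>i\<in>I. c i * t i) - (\<Sum>i\<in>I. c i * u i)) < \<epsilon>"
    if "\<And>i. i \<in> I \<Longrightarrow> norm (t i - u i) < \<epsilon> / S" for t u
  proof -
    have "norm ((\<Sum>i\<in>I. c i * t i) - (\<Sum>i\<in>I. c i * u i)) = norm (\<Sum>i\<in>I. c i * (t i - u i))"
      by (simp add: sum_subtractf algebra_simps)
    also have "\<dots> \<le> (\<Sum>i\<in>I. norm (c i) * (\<epsilon> / S))"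
      unfolding norm_mult using that
      by (intro sum_norm_le) (simp add: norm_mult mult_left_mono less_imp_le del: times_divide_eq_right)
    also have "\<dots> = (S - 1) * (\<epsilon> / S)" by (simp add: S_def sum_distrib_right sum_divide_distrib)
    also have "\<dots> < \<epsilon>" using S assms(2) by (simp add: field_simps)
    finally show ?thesis .
  qed
  then show thesis using that[of "\<epsilon> / S"] S assms(2) by auto
qed

text \<open>
  The joint values of finitely many functionals fill a linear subspace of a finite-dimensional
  coordinate space, and such a subspace is closed. The induction proves this closedness directly, in
  the only form that is used later.
\<close>

lemma approximable_values_attained:
  fixes \<phi> :: "'i \<Rightarrow> 'b::ab_group_add \<Rightarrow> complex"
  assumes "finite I" "\<And>i. i \<in> I \<Longrightarrow> Vector_Spaces.linear s (*) (\<phi> i)"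
    and "\<And>\<epsilon>::real. 0 < \<epsilon> \<Longrightarrow> \<exists>y. \<forall>i\<in>I. norm (\<phi> i y - t i) < \<epsilon>"
  shows "\<exists>y. \<forall>i\<in>I. \<phi> i y = t i"
  using assms
proof (induction I rule: finite_induct)
  case empty
  then show ?case by simp
next
  case (insert j I)
  note lin = insert.prems(1)
  have "\<exists>y. \<forall>i\<in>I. \<phi> i y = t i"
  proof (rule insert.IH)
    fix \<epsilon>::real assume "0 < \<epsilon>" then show "\<exists>y. \<forall>i\<in>I. norm (\<phi> i y - t i) < \<epsilon>"
      using insert.prems(2)[of \<epsilon>] by blast
  qed (use lin in auto)
  then obtain y where y: "\<And>i. i \<in> I \<Longrightarrow> \<phi> i y = t i" by blast
  show ?case
  proof (cases "\<forall>y. (\<forall>i\<in>I. \<phi> i y = 0) \<longrightarrow> \<phi> j y = 0")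
    case True
    have "\<exists>c. \<forall>y. \<phi> j y = (\<Sum>i\<in>I. c i * \<phi> i y)"
      by (rule functional_vanishing_on_common_kernel[OF insert.hyps(1)]) (use True lin in auto)
    then obtain c where c: "\<And>y. \<phi> j y = (\<Sum>i\<in>I. c i * \<phi> i y)" by blast
    have "norm (\<phi> j y - t j) < \<epsilon>" if "0 < \<epsilon>" for \<epsilon>::real
    proof -
      obtain \<delta> where \<delta>: "0 < \<delta>" "\<And>t u. (\<And>i. i \<in> I \<Longrightarrow> norm (t i - u i) < \<delta>) \<Longrightarrow>
          norm ((\<Sum>i\<in>I. c i * t i) - (\<Sum>i\<in>I. c i * u i)) < \<epsilon> / 2"
        using norm_linear_combination_less[OF insert.hyps(1), of "\<epsilon>/2" c] \<open>0 < \<epsilon>\<close> by auto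
      obtain z where z: "\<And>i. i \<in> insert j I \<Longrightarrow> norm (\<phi> i z - t i) < min \<delta> (\<epsilon> / 2)"
        using insert.prems(2)[of "min \<delta> (\<epsilon> / 2)"] \<delta>(1) \<open>0 < \<epsilon>\<close> by auto
      have "norm (\<phi> j z - \<phi> j y) < \<epsilon> / 2"
        unfolding c by (rule \<delta>(2)) (use z y in auto)
      moreover have "norm (\<phi> j z - t j) < \<epsilon> / 2" using z[of j] by simp
      ultimately show ?thesis
        using norm_triangle_ineq4[of "\<phi> j z - t j" "\<phi> j z - \<phi> j y"] by simp
    qed
    then have "norm (\<phi> j y - t j) \<le> 0"
      by (meson linorder_not_le less_irrefl)
    then show ?thesis using y by auto
  next
    case False
    then obtain y0 where y0: "\<And>i. i \<in> I \<Longrightarrow> \<phi> i y0 = 0" "\<phi> j y0 \<noteq> 0" by blast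
    define b where "b = (t j - \<phi> j y) / \<phi> j y0"
    have *: "\<phi> i (y + s b y0) = \<phi> i y + b * \<phi> i y0" if "i \<in> insert j I" for i
      using lin[OF that] by (simp add: Vector_Spaces.linear_iff)
    have "\<forall>i\<in>insert j I. \<phi> i (y + s b y0) = t i"
      using y y0 * by (auto simp: b_def)
    then show ?thesis by blast
  qed
qed

section \<open>Ideals of complex polynomials\<close>

lemma complex_poly_ideal_generated:
  fixes J :: "complex poly set"
  assumes "\<And>p q. p \<in> J \<Longrightarrow> q \<in> J \<Longrightarrow> p - q \<in> J" "\<And>p q. p \<in> J \<Longrightarrow> q * p \<in> J" "0 \<in> J"
  obtains p where "p \<in> J" "\<And>q. q \<in> J \<Longrightarrow> p dvd q"
proof (cases "J \<subseteq> {0}")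
  case True
  then show ?thesis using that[of 0] assms(3) by auto
next
  case False
  define d where "d = (LEAST d. \<exists>p\<in>J. p \<noteq> 0 \<and> degree p = d)"
  have "\<exists>d. \<exists>p\<in>J. p \<noteq> 0 \<and> degree p = d" using False by auto
  from LeastI_ex[OF this] obtain p where p: "p \<in> J" "p \<noteq> 0" "degree p = d"
    unfolding d_def by auto
  have "p dvd q" if "q \<in> J" for q
  proof (rule ccontr)
    assume "\<not> p dvd q"
    then have nz: "q mod p \<noteq> 0" by (simp add: mod_eq_0_iff_dvd)
    have "q mod p \<in> J" using assms(1)[OF that assms(2)[OF p(1), of "q div p"]]
      by (simp add: minus_div_mult_eq_mod)
    then have "d \<le> degree (q mod p)" unfolding d_def using nz by (intro Least_le) auto
    then show False using degree_mod_less[OF p(2), of q] nz p(3) by simp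
  qed
  then show thesis using that p(1) by blast
qed

lemma complex_poly_root_or_unit:
  fixes p :: "complex poly"
  shows "p dvd 1 \<or> (\<exists>a. [:-a, 1:] dvd p)"
proof (cases "p = 0 \<or> degree p = 0")
  case True
  then show ?thesis by (metis dvd_0_right is_unit_iff_degree)
next
  case False
  then have "\<not> constant (poly p)" by (simp add: constant_degree)
  then show ?thesis using fundamental_theorem_of_algebra poly_eq_0_iff_dvd by blast
qed

text \<open>
  A proper ideal of complex polynomials is generated by zero or by a polynomial with a root. In the
  application the ideal consists of the polynomials in the operator that annihilate the cyclic vector
  modulo an invariant subspace, so that this is the existence of an eigenvalue of the quotient
  operator (or of its adjoint).
\<close>

lemma complex_poly_ideal_one_root:
  fixes J :: "complex poly set"
  assumes "\<And>p q. p \<in> J \<Longrightarrow> q \<in> J \<Longrightarrow> p - q \<in> J" "\<And>p q. p \<in> J \<Longrightarrow> q * p \<in> J" "0 \<in> J"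
  shows "1 \<in> J \<or> (\<exists>a. \<forall>g\<in>J. [:-a, 1:] dvd g)"
proof -
  obtain p where p: "p \<in> J" "\<And>q. q \<in> J \<Longrightarrow> p dvd q"
    using complex_poly_ideal_generated assms by metis
  from complex_poly_root_or_unit[of p] show ?thesis
  proof
    assume "p dvd 1"
    then obtain q where "1 = p * q" by (elim dvdE)
    then show ?thesis using assms(2)[OF p(1), of q] by (simp add: mult.commute)
  qed (use p dvd_trans in blast)
qed

text \<open>
  An ideal of codimension at least two lies in one of codimension exactly two. The first alternative
  covers codimension at most one.
\<close>

lemma complex_poly_ideal_two_roots:
  fixes J :: "complex poly set"
  assumes "\<And>p q. p \<in> J \<Longrightarrow> q \<in> J \<Longrightarrow> p - q \<in> J" "\<And>p q. p \<in> J \<Longrightarrow> q * p \<in> J" "0 \<in> J"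
  shows "(\<exists>a. [:-a, 1:] \<in> J) \<or> (\<exists>a b. \<forall>g\<in>J. [:-a, 1:] * [:-b, 1:] dvd g)"
proof -
  obtain p where p: "p \<in> J" "\<And>q. q \<in> J \<Longrightarrow> p dvd q"
    using complex_poly_ideal_generated assms by metis
  have multiples: "r \<in> J" if "p dvd r" for r
    using that assms(2)[OF p(1)] by (metis dvdE mult.commute)
  from complex_poly_root_or_unit[of p] show ?thesis
  proof
    assume "p dvd 1"
    then have "p dvd [:-0, 1:]" using dvd_trans one_dvd by blast
    then show ?thesis using multiples by blast
  next
    assume "\<exists>a. [:-a, 1:] dvd p"
    then obtain a q where q: "p = [:-a, 1:] * q" by (elim exE dvdE)
    from complex_poly_root_or_unit[of q] show ?thesis
    proof
      assume "q dvd 1"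
      then have "p dvd [:-a, 1:]" unfolding q by (metis mult.right_neutral mult_dvd_mono dvd_refl)
      then show ?thesis using multiples by blast
    next
      assume "\<exists>b. [:-b, 1:] dvd q"
      then obtain b where "[:-b, 1:] dvd q" by blast
      then have "[:-a, 1:] * [:-b, 1:] dvd p" unfolding q by (rule mult_dvd_mono[OF dvd_refl])
      then show ?thesis using p(2) dvd_trans by blast
    qed
  qed
qed

section \<open>Orbits in dimension one and two\<close>

lemma powers_not_dense:
  fixes a :: complex
  assumes "\<And>t \<epsilon>::real. 0 < \<epsilon> \<Longrightarrow> \<exists>n. norm (a ^ n - complex_of_real t) < \<epsilon>"
  shows False
proof (cases "norm a \<le> 1")
  case True
  obtain n where "norm (a ^ n - complex_of_real 3) < 1" using assms[of 1 3] by auto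
  moreover have "norm (a ^ n) \<le> 1" using True by (simp add: norm_power power_le_one)
  moreover have "norm (complex_of_real 3) = 3" by simp
  ultimately show False
    using norm_triangle_ineq2[of "complex_of_real 3" "a ^ n"] by (simp add: norm_minus_commute)
next
  case False
  obtain n where "norm (a ^ n - complex_of_real 0) < 1" using assms[of 1 0] by auto
  then have "norm a ^ n < 1" by (simp add: norm_power)
  moreover have "1 \<le> norm a ^ n" using False by (intro one_le_power) auto
  ultimately show False by simp
qed

text \<open>
  The orbit of \<open>(1, 1)\<close> under a diagonal matrix, up to scalars: if \<open>norm a \<le> norm b\<close>, the first
  coordinate never dominates the second.
\<close>

lemma scaled_power_pairs_not_dense:
  fixes a b :: complex
  assumes dense: "\<And>s t. \<And>\<epsilon>::real. 0 < \<epsilon> \<Longrightarrow>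
      \<exists>c n. norm (c * a ^ n - s) < \<epsilon> \<and> norm (c * b ^ n - t) < \<epsilon>"
  shows False
proof -
  have *: False if le: "norm a \<le> norm b" and d: "norm (c * a ^ n - 3) < 1" "norm (c * b ^ n - 1) < 1"
    for a b c :: complex and n
  proof -
    have "norm (c * a ^ n) \<le> norm (c * b ^ n)"
      using le by (simp add: norm_mult norm_power mult_left_mono power_mono)
    moreover have "norm (3::complex) = 3" "norm (1::complex) = 1" by simp_all
    ultimately show False
      using d norm_triangle_ineq2[of 3 "c * a ^ n"] norm_triangle_ineq2[of "c * b ^ n" 1]
      by (simp add: norm_minus_commute)
  qed
  show False
  proof (cases "norm a \<le> norm b")
    case True
    then show False using * dense[of 1 3 1] by auto
  next
    case False
    then have "norm b \<le> norm a" by simp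
    then show False using *[of b a _ _] dense[of 1 1 3] by auto
  qed
qed

text \<open>
  The orbit of a cyclic vector of a Jordan block, up to scalars. If \<open>a\<close> is not zero, the quotient of
  the second coordinate by the first is \<open>of_nat n / a\<close>, which stays away from \<open>- 1 / a\<close>.
\<close>

lemma scaled_jordan_pairs_not_dense:
  fixes a :: complex
  assumes dense: "\<And>s t. \<And>\<epsilon>::real. 0 < \<epsilon> \<Longrightarrow>
      \<exists>c n. norm (c * a ^ n - s) < \<epsilon> \<and> norm (c * (of_nat n * a ^ (n - 1)) - t) < \<epsilon>"
  shows False
proof (cases "a = 0")
  case True
  obtain c n where cn: "norm (c * a ^ n - 1) < 1" "norm (c * (of_nat n * a ^ (n - 1)) - 1) < 1"
    using dense[of 1 1 1] by auto
  show False
    using cn True by (cases "n = 0") (auto simp: power_0_left)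
next
  case False
  define \<epsilon> where "\<epsilon> = min 1 (inverse (norm a))"
  have \<epsilon>: "0 < \<epsilon>" "\<epsilon> \<le> 1" "\<epsilon> * norm a \<le> 1" using False by (auto simp: \<epsilon>_def field_simps min_def)
  obtain c n where cn: "norm (c * a ^ n - 1) < \<epsilon>"
      "norm (c * (of_nat n * a ^ (n - 1)) - (- 1 / a)) < \<epsilon>"
    using dense[OF \<epsilon>(1), of 1 "-1/a"] by auto
  have "0 \<le> Re (c * a ^ n)"
    using abs_Re_le_cmod[of "c * a ^ n - 1"] cn(1) \<epsilon>(2) by simp
  then have "0 \<le> Re (of_nat n * (c * a ^ n))" by simp
  also have "of_nat n * (c * a ^ n) = a * (c * (of_nat n * a ^ (n - 1)))"
    by (cases n) (simp_all add: algebra_simps)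
  finally have 1: "0 \<le> Re (a * (c * (of_nat n * a ^ (n - 1))))" .
  have "norm (a * (c * (of_nat n * a ^ (n - 1))) + 1)
      = norm a * norm (c * (of_nat n * a ^ (n - 1)) - (- 1 / a))"
    using False unfolding norm_mult[symmetric] by (simp add: algebra_simps)
  also have "\<dots> < norm a * \<epsilon>" using cn(2) False by simp
  also have "\<dots> \<le> 1" using \<epsilon>(3) by (simp add: mult.commute)
  finally have "\<bar>Re (a * (c * (of_nat n * a ^ (n - 1))) + 1)\<bar> < 1"
    using abs_Re_le_cmod order_le_less_trans by blast
  then show False using 1 by simp
qed


section \<open>Orbits observed through finitely many functionals\<close>

text \<open>
  The vector \<open>p(S) x\<close>, computed by Horner's rule.
\<close>

definition poly_orbit ::
    "(complex \<Rightarrow> 'b::ab_group_add \<Rightarrow> 'b) \<Rightarrow> ('b \<Rightarrow> 'b) \<Rightarrow> 'b \<Rightarrow> complex poly \<Rightarrow> 'b"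
  where "poly_orbit s S x p = fold_coeffs (\<lambda>a y. s a x + S y) p 0"

text \<open>
  An operator \<open>S\<close> with an orbit in \<open>V\<close>, an invariant subspace \<open>W\<close>, and finitely many functionals
  on \<open>V\<close> whose common kernel lies in \<open>W\<close>, so that \<open>V\<close> is finite-dimensional modulo \<open>W\<close>. The operator
  need not map \<open>V\<close> to itself. The span of the orbit is a replacement for \<open>V\<close> that is invariant; it is the
  image of the polynomials under \<open>ev\<close>, and the statements below are about polynomials for this reason.
\<close>

locale observed_orbit = S: Vector_Spaces.linear s s S
  for s :: "complex \<Rightarrow> 'b::ab_group_add \<Rightarrow> 'b" and S :: "'b \<Rightarrow> 'b" +
  fixes x :: 'b and V W :: "'b set" and N :: "'i set" and \<phi> :: "'i \<Rightarrow> 'b \<Rightarrow> complex"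
  assumes V: "S.vs1.subspace V"
    and W: "S.vs1.subspace W" "S ` W \<subseteq> W"
    and orbit: "\<And>n. (S ^^ n) x \<in> V"
    and finite: "finite N"
    and add: "\<And>i v w. i \<in> N \<Longrightarrow> v \<in> V \<Longrightarrow> w \<in> V \<Longrightarrow> \<phi> i (v + w) = \<phi> i v + \<phi> i w"
    and scale: "\<And>i c v. i \<in> N \<Longrightarrow> v \<in> V \<Longrightarrow> \<phi> i (s c v) = c * \<phi> i v"
    and kernel: "\<And>v. v \<in> V \<Longrightarrow> (\<And>i. i \<in> N \<Longrightarrow> \<phi> i v = 0) \<Longrightarrow> v \<in> W"
begin

abbreviation ev :: "complex poly \<Rightarrow> 'b" where "ev \<equiv> poly_orbit s S x"

lemma ev_0 [simp]: "ev 0 = 0"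
  by (simp add: poly_orbit_def)

lemma ev_pCons [simp]: "ev (pCons a p) = s a x + S (ev p)"
  by (cases "p = 0 \<and> a = 0") (auto simp: poly_orbit_def)

lemma ev_add: "ev (p + q) = ev p + ev q"
proof (induction p q rule: poly_induct2)
  case (pCons a p b q)
  then show ?case by (simp add: S.add S.vs1.scale_left_distrib algebra_simps)
qed simp

lemma ev_smult: "ev (smult c p) = s c (ev p)"
  by (induction p) (simp_all add: S.scale S.vs1.scale_right_distrib)

lemma ev_diff: "ev (p - q) = ev p - ev q"
  using ev_add[of "p - q" q] by simp

lemma linear_funpow: "Vector_Spaces.linear s s (S ^^ n)"
proof (induction n)
  case 0
  then show ?case using S.linear_axioms by (simp add: Vector_Spaces.linear_iff)
next
  case (Suc n)
  then show ?case using S.linear_axioms by (simp add: Vector_Spaces.linear_iff)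
qed

lemma ev_monom: "ev (monom 1 n) = (S ^^ n) x"
  by (induction n) (simp_all add: monom_0 monom_Suc)

lemma ev_in_V: "ev p \<in> V"
proof -
  have "(S ^^ n) (ev p) \<in> V" for n
  proof (induction p arbitrary: n)
    case 0
    then show ?case using linear_funpow[of n] S.vs1.subspace_0[OF V]
      by (metis ev_0 Vector_Spaces.linear_iff add_cancel_right_right)
  next
    case (pCons a p)
    have "(S ^^ n) (ev (pCons a p)) = s a ((S ^^ n) x) + (S ^^ Suc n) (ev p)"
      using linear_funpow[of n] by (simp add: Vector_Spaces.linear_iff funpow_swap1)
    then show ?case
      using pCons.IH[of "Suc n"] orbit[of n] V by (auto intro: S.vs1.subspace_add S.vs1.subspace_scale)
  qed
  from this[of 0] show ?thesis by simp
qed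

definition annihilator :: "complex poly set" where "annihilator = {g. ev g \<in> W}"

lemma annihilator_diff: "p \<in> annihilator \<Longrightarrow> q \<in> annihilator \<Longrightarrow> p - q \<in> annihilator"
  by (simp add: annihilator_def ev_diff S.vs1.subspace_diff W)

lemma annihilator_0: "0 \<in> annihilator"
  by (simp add: annihilator_def S.vs1.subspace_0 W)

lemma annihilator_mult: "p \<in> annihilator \<Longrightarrow> q * p \<in> annihilator"
proof (induction q)
  case 0
  then show ?case by (simp add: annihilator_0)
next
  case (pCons a q)
  then have "S (ev (q * p)) \<in> W" using W(2) by (auto simp: annihilator_def)
  then show ?case
    using pCons.prems W(1)
    by (simp add: annihilator_def ev_add ev_smult S.vs1.subspace_add S.vs1.subspace_scale)
qed

lemma linear_on_polynomials: "i \<in> N \<Longrightarrow> Vector_Spaces.linear smult (*) (\<lambda>g. \<phi> i (ev g))"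
  unfolding Vector_Spaces.linear_iff
  by (auto simp: ev_add ev_smult add scale ev_in_V smult_add_right smult_add_left vector_space_def algebra_simps)

text \<open>
  A functional on polynomials that vanishes on the annihilator only depends on the observed values.
  Hence it inherits approximations from them: this plays the role of continuity.
\<close>

lemma functional_factors:
  assumes "Vector_Spaces.linear smult (*) e" "\<And>g. g \<in> annihilator \<Longrightarrow> e g = 0"
  obtains c where "\<And>g. e g = (\<Sum>i\<in>N. c i * \<phi> i (ev g))"
proof -
  have "\<exists>c. \<forall>g. e g = (\<Sum>i\<in>N. c i * \<phi> i (ev g))"
    by (rule functional_vanishing_on_common_kernel[OF finite linear_on_polynomials assms(1)])
      (use assms(2) kernel ev_in_V in \<open>auto simp: annihilator_def\<close>)
  then show thesis using that by blast
qed

text \<open>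
  Modulo \<open>W\<close>, a vector that the span of the orbit approximates already lies in this span, because
  only finitely many coordinates count.
\<close>

lemma weakly_dense_orbit_modulo_W:
  assumes "v \<in> V" "\<And>\<epsilon>::real. 0 < \<epsilon> \<Longrightarrow> \<exists>g. \<forall>i\<in>N. norm (\<phi> i (ev g) - \<phi> i v) < \<epsilon>"
  obtains g where "v - ev g \<in> W"
proof -
  have "\<exists>g. \<forall>i\<in>N. \<phi> i (ev g) = \<phi> i v"
    by (rule approximable_values_attained[OF finite linear_on_polynomials]) (use assms(2) in auto)
  then obtain g where g: "\<forall>i\<in>N. \<phi> i (ev g) = \<phi> i v" by blast
  have "v - ev g \<in> V" using assms(1) ev_in_V V by (simp add: S.vs1.subspace_diff)
  moreover have "\<phi> i (v - ev g) = 0" if "i \<in> N" for i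
    using add[OF that, of "v - ev g" "ev g"] ev_in_V[of g] \<open>v - ev g \<in> V\<close> g that by simp
  ultimately show thesis using kernel that by blast
qed

text \<open>
  If the quotient modulo \<open>W\<close> is not zero, then \<open>\<lambda>g. poly g a\<close> for some \<open>a\<close> is an eigenfunctional of the
  adjoint, and it sends the orbit to the powers of \<open>a\<close>, which are not dense.
\<close>

lemma weakly_hypercyclic_imp_subset:
  assumes dense: "\<And>v \<epsilon>. v \<in> V \<Longrightarrow> 0 < (\<epsilon>::real) \<Longrightarrow> \<exists>n. \<forall>i\<in>N. norm (\<phi> i ((S ^^ n) x) - \<phi> i v) < \<epsilon>"
  shows "V \<subseteq> W"
proof
  fix v assume v: "v \<in> V"
  consider "1 \<in> annihilator" | a where "\<And>g. g \<in> annihilator \<Longrightarrow> [:-a, 1:] dvd g"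
    using complex_poly_ideal_one_root[OF annihilator_diff annihilator_mult annihilator_0] by blast
  then show "v \<in> W"
  proof cases
    case 1
    have "\<exists>g. \<forall>i\<in>N. norm (\<phi> i (ev g) - \<phi> i v) < \<epsilon>" if "0 < \<epsilon>" for \<epsilon>::real
      using dense[OF v that] ev_monom by metis
    then obtain g where "v - ev g \<in> W"
      using weakly_dense_orbit_modulo_W[OF v] by blast
    moreover have "ev g \<in> W" using annihilator_mult[OF 1, of g] by (simp add: annihilator_def)
    ultimately have "(v - ev g) + ev g \<in> W" using W(1) S.vs1.subspace_add by blast
    then show ?thesis by simp
  next
    case (2 a)
    have lin: "Vector_Spaces.linear smult (*) (\<lambda>g. poly g a)"
      by (simp add: Vector_Spaces.linear_iff vector_space_def smult_add_right smult_add_left algebra_simps)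
    obtain c where c: "\<And>g. poly g a = (\<Sum>i\<in>N. c i * \<phi> i (ev g))"
      by (rule functional_factors[OF lin]) (use 2 poly_eq_0_iff_dvd in blast)+
    have "\<exists>n. norm (a ^ n - complex_of_real t) < \<epsilon>" if \<epsilon>: "0 < \<epsilon>" for t \<epsilon>
    proof -
      obtain \<delta> where \<delta>: "0 < \<delta>" "\<And>t u. (\<And>i. i \<in> N \<Longrightarrow> norm (t i - u i) < \<delta>) \<Longrightarrow>
          norm ((\<Sum>i\<in>N. c i * t i) - (\<Sum>i\<in>N. c i * u i)) < \<epsilon>"
        using norm_linear_combination_less[OF finite \<epsilon>, of c] by metis
      obtain n where "\<forall>i\<in>N. norm (\<phi> i (ev (monom 1 n)) - \<phi> i (ev [:of_real t:])) < \<delta>"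
        using dense[OF ev_in_V \<delta>(1)] ev_monom by metis
      then have "norm (poly (monom 1 n) a - poly [:of_real t:] a) < \<epsilon>"
        unfolding c by (intro \<delta>(2)) auto
      then show ?thesis by (auto simp: poly_monom)
    qed
    then show ?thesis using powers_not_dense by blast
  qed
qed

text \<open>
  If the quotient modulo \<open>W\<close> is more than the line spanned by \<open>x\<close>, two independent functionals on
  polynomials span an invariant subspace of the adjoint: evaluation at two points, or evaluation and
  derivative at a double root. They turn the multiples of the orbit into one of the two families of
  pairs that were shown not to be dense.
\<close>

lemma weakly_supercyclic_imp_subset:
  assumes dense: "\<And>v \<epsilon>. v \<in> V \<Longrightarrow> 0 < (\<epsilon>::real) \<Longrightarrow>
      \<exists>c n. \<forall>i\<in>N. norm (\<phi> i (s c ((S ^^ n) x)) - \<phi> i v) < \<epsilon>"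
    and v: "v \<in> V"
  shows "\<exists>c. v - s c x \<in> W"
proof -
  consider a where "[:-a, 1:] \<in> annihilator" | a b where "\<And>g. g \<in> annihilator \<Longrightarrow> [:-a, 1:] * [:-b, 1:] dvd g"
    using complex_poly_ideal_two_roots[OF annihilator_diff annihilator_mult annihilator_0] by blast
  then show ?thesis
  proof cases
    case (1 a)
    have "\<exists>g. \<forall>i\<in>N. norm (\<phi> i (ev g) - \<phi> i v) < \<epsilon>" if "0 < \<epsilon>" for \<epsilon>::real
      using dense[OF v that] ev_monom ev_smult by metis
    then obtain g where g: "v - ev g \<in> W"
      using weakly_dense_orbit_modulo_W[OF v] by blast
    \<comment> \<open>Modulo \<open>X - a\<close> every polynomial is the constant \<open>poly g a\<close>, so \<open>g(S) x\<close> is a multiple of \<open>x\<close>.\<close>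
    have "[:-a, 1:] dvd g - [:poly g a:]"
      using poly_eq_0_iff_dvd[of "g - [:poly g a:]" a] by simp
    then have "g - [:poly g a:] \<in> annihilator" using annihilator_mult[OF 1] by (metis dvdE mult.commute)
    then have "ev g - s (poly g a) x \<in> W" by (simp add: annihilator_def ev_diff)
    then have "(v - ev g) + (ev g - s (poly g a) x) \<in> W" using g W(1) S.vs1.subspace_add by blast
    then show ?thesis by auto
  next
    case (2 a b)
    define e where "e g = (if a = b then poly (pderiv g) a else poly g b)" for g
    have lin: "Vector_Spaces.linear smult (*) (\<lambda>g. poly g a)" "Vector_Spaces.linear smult (*) e"
      by (simp_all add: Vector_Spaces.linear_iff vector_space_def smult_add_right smult_add_left
          e_def pderiv_add pderiv_smult algebra_simps)
    have vanish: "poly g a = 0" "e g = 0" if g: "g \<in> annihilator" for g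
    proof -
      obtain h where "g = [:-a, 1:] * [:-b, 1:] * h" using 2[OF g] by (elim dvdE)
      then show "poly g a = 0" "e g = 0"
        by (simp_all add: e_def pderiv_mult pderiv_pCons del: mult_pCons_left)
    qed
    obtain c where c: "\<And>g. poly g a = (\<Sum>i\<in>N. c i * \<phi> i (ev g))"
      by (rule functional_factors[OF lin(1)]) (use vanish in blast)+
    obtain d where d: "\<And>g. e g = (\<Sum>i\<in>N. d i * \<phi> i (ev g))"
      by (rule functional_factors[OF lin(2)]) (use vanish in blast)+
    have approx: "\<exists>k n. norm (poly (smult k (monom 1 n)) a - poly g a) < \<epsilon> \<and>
        norm (e (smult k (monom 1 n)) - e g) < \<epsilon>" if \<epsilon>: "0 < \<epsilon>" for g \<epsilon>
    proof -
      obtain \<delta> where \<delta>: "0 < \<delta>" "\<And>t u. (\<And>i. i \<in> N \<Longrightarrow> norm (t i - u i) < \<delta>) \<Longrightarrow>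
          norm ((\<Sum>i\<in>N. c i * t i) - (\<Sum>i\<in>N. c i * u i)) < \<epsilon>"
        using norm_linear_combination_less[OF finite \<epsilon>, of c] by metis
      obtain \<eta> where \<eta>: "0 < \<eta>" "\<And>t u. (\<And>i. i \<in> N \<Longrightarrow> norm (t i - u i) < \<eta>) \<Longrightarrow>
          norm ((\<Sum>i\<in>N. d i * t i) - (\<Sum>i\<in>N. d i * u i)) < \<epsilon>"
        using norm_linear_combination_less[OF finite \<epsilon>, of d] by metis
      have "0 < min \<delta> \<eta>" using \<delta>(1) \<eta>(1) by simp
      then obtain k n where
          *: "\<forall>i\<in>N. norm (\<phi> i (ev (smult k (monom 1 n))) - \<phi> i (ev g)) < min \<delta> \<eta>"
        using dense[OF ev_in_V[of g], of "min \<delta> \<eta>"] unfolding ev_monom[symmetric] ev_smult[symmetric] by blast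
      have "norm (poly (smult k (monom 1 n)) a - poly g a) < \<epsilon>"
        unfolding c by (intro \<delta>(2)) (use * in auto)
      moreover have "norm (e (smult k (monom 1 n)) - e g) < \<epsilon>"
        unfolding d by (intro \<eta>(2)) (use * in auto)
      ultimately show ?thesis by blast
    qed
    show ?thesis
    proof (cases "a = b")
      case True
      have "\<exists>c n. norm (c * a ^ n - \<alpha>) < \<epsilon> \<and> norm (c * (of_nat n * a ^ (n - 1)) - \<beta>) < \<epsilon>"
        if "0 < \<epsilon>" for \<alpha> \<beta> \<epsilon>
        using approx[OF that, of "[:\<alpha> - \<beta> * a, \<beta>:]"] True
        by (simp add: e_def poly_monom pderiv_monom pderiv_smult pderiv_pCons mult.commute)
      then show ?thesis using scaled_jordan_pairs_not_dense by blast
    next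
      case False
      have "\<exists>c n. norm (c * a ^ n - \<alpha>) < \<epsilon> \<and> norm (c * b ^ n - \<beta>) < \<epsilon>"
        if "0 < \<epsilon>" for \<alpha> \<beta> \<epsilon>
      proof -
        \<comment> \<open>The linear polynomial that interpolates \<open>\<alpha>\<close> at \<open>a\<close> and \<open>\<beta>\<close> at \<open>b\<close>.\<close>
      define \<gamma> where "\<gamma> = (\<beta> - \<alpha>) / (b - a)"
        have "\<gamma> * (b - a) = \<beta> - \<alpha>" using False by (simp add: \<gamma>_def)
        then have "poly [:\<alpha> - \<gamma> * a, \<gamma>:] a = \<alpha>" "poly [:\<alpha> - \<gamma> * a, \<gamma>:] b = \<beta>"
          by (simp_all add: algebra_simps)
        then show ?thesis
          using approx[OF that, of "[:\<alpha> - \<gamma> * a, \<gamma>:]"] False by (simp add: e_def poly_monom)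
      qed
      then show ?thesis using scaled_power_pairs_not_dense by blast
    qed
  qed
qed

end

section \<open>Cauchy's formula on polydiscs\<close>

definition polydisc :: "real \<Rightarrow> (complex ^ 'n) set"
  where "polydisc \<rho> = {z. \<forall>i. norm (z $ i) \<le> \<rho>}"

definition vupd :: "complex ^ 'n \<Rightarrow> 'n \<Rightarrow> complex \<Rightarrow> complex ^ 'n"
  where "vupd z i \<zeta> = (\<chi> j. if j = i then \<zeta> else z $ j)"

definition circ :: "real \<Rightarrow> real \<Rightarrow> complex"
  where "circ \<rho> t = of_real \<rho> * exp (2 * of_real pi * \<i> * of_real t)"

text \<open>
  The contour integral of \<open>k(\<zeta>) H / \<zeta>\<close> over the circle of radius \<open>\<rho>\<close> in the coordinate \<open>i\<close>, divided by
  \<open>2 \<pi> \<i>\<close>. Writing it as an integral over an interval makes continuity in parameters and interchange of the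
  order of integration available.
\<close>

definition circle_mean ::
    "real \<Rightarrow> 'n \<Rightarrow> (complex \<Rightarrow> complex) \<Rightarrow> (complex ^ 'n \<Rightarrow> complex) \<Rightarrow> complex ^ 'n \<Rightarrow> complex"
  where "circle_mean \<rho> i k H z = integral {0..1} (\<lambda>t. k (circ \<rho> t) * H (vupd z i (circ \<rho> t)))"

definition cauchy_kernel :: "complex \<Rightarrow> complex \<Rightarrow> complex"
  where "cauchy_kernel w \<zeta> = \<zeta> / (\<zeta> - w)"

text \<open>
  Continuous functions on the closed polydisc that satisfy Cauchy's formula in each coordinate. They
  are the ones that are holomorphic in each coordinate on the open disc, but in this form the class is
  visibly stable under integration in one coordinate, without differentiation under the integral sign.
\<close>

definition cauchy_class :: "real \<Rightarrow> (complex ^ 'n \<Rightarrow> complex) set"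
  where "cauchy_class \<rho> = {H. continuous_on (polydisc \<rho>) H \<and>
    (\<forall>i. \<forall>z\<in>polydisc \<rho>. norm (z $ i) < \<rho> \<longrightarrow>
      circle_mean \<rho> i (cauchy_kernel (z $ i)) H z = H z)}"

lemma norm_circ [simp]: "0 \<le> \<rho> \<Longrightarrow> norm (circ \<rho> t) = \<rho>"
  by (simp add: circ_def norm_mult norm_exp_eq_Re)

lemma continuous_on_circ [continuous_intros]: "continuous_on S (circ \<rho>)"
  unfolding circ_def by (intro continuous_intros)

lemma continuous_on_vupd [continuous_intros]:
  fixes f :: "'a::topological_space \<Rightarrow> complex ^ 'n"
  assumes "continuous_on S f" "continuous_on S g"
  shows "continuous_on S (\<lambda>x. vupd (f x) i (g x))"
proof -
  have "continuous_on S (\<lambda>x. if j = i then g x else f x $ j)" for j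
    by (cases "j = i") (auto intro!: continuous_intros assms)
  then show ?thesis unfolding vupd_def by (rule continuous_on_vec_lambda)
qed

lemma polydisc_mono: "\<rho> \<le> \<sigma> \<Longrightarrow> polydisc \<rho> \<subseteq> polydisc \<sigma>"
  by (auto simp: polydisc_def intro: order_trans)

lemma vupd_in_polydisc: "z \<in> polydisc \<rho> \<Longrightarrow> norm \<zeta> \<le> \<rho> \<Longrightarrow> vupd z i \<zeta> \<in> polydisc \<rho>"
  by (simp add: polydisc_def vupd_def)

lemma vupd_simps [simp]:
  "vupd z i \<zeta> $ i = \<zeta>" "j \<noteq> i \<Longrightarrow> vupd z i \<zeta> $ j = z $ j"
  "vupd (vupd z i \<zeta>) i \<xi> = vupd z i \<xi>" "vupd z i (z $ i) = z"
  by (auto simp: vupd_def vec_eq_iff)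

lemma vupd_commute: "i \<noteq> j \<Longrightarrow> vupd (vupd z i \<zeta>) j \<xi> = vupd (vupd z j \<xi>) i \<zeta>"
  by (auto simp: vupd_def vec_eq_iff)

lemma norm_le_sum_components: "norm (z :: complex ^ 'n) \<le> (\<Sum>i\<in>UNIV. norm (z $ i))"
  unfolding norm_vec_def by (rule L2_set_le_sum) simp

lemma norm_le_polydisc:
  assumes "z \<in> polydisc \<rho>"
  shows "norm (z :: complex ^ 'n) \<le> of_nat CARD('n) * \<rho>"
proof -
  have "(\<Sum>i\<in>UNIV. norm (z $ i)) \<le> of_nat CARD('n) * \<rho>"
    using assms by (intro sum_bounded_above) (auto simp: polydisc_def)
  with norm_le_sum_components show ?thesis by (rule order_trans)
qed

lemma compact_polydisc: "compact (polydisc \<rho> :: (complex ^ 'n) set)"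
proof -
  have "polydisc \<rho> = (\<Inter>i. {z :: complex ^ 'n. norm (z $ i) \<le> \<rho>})"
    by (auto simp: polydisc_def)
  moreover have "closed {z :: complex ^ 'n. norm (z $ i) \<le> \<rho>}" for i
    by (intro closed_Collect_le continuous_intros)
  ultimately have "closed (polydisc \<rho> :: (complex ^ 'n) set)" by auto
  then show ?thesis
    unfolding compact_eq_bounded_closed bounded_iff using norm_le_polydisc by blast
qed

context
  fixes \<rho> :: real assumes \<rho>: "0 < \<rho>"
begin

lemma circ_in_sphere: "circ \<rho> t \<in> sphere 0 \<rho>"
  using \<rho> by simp

lemma continuous_on_circle_mean_integrand:
  fixes H :: "complex ^ 'n \<Rightarrow> complex"
  assumes k: "continuous_on (sphere 0 \<rho>) k" and H: "continuous_on (polydisc \<rho>) H"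
  shows "continuous_on (polydisc \<rho> \<times> S) (\<lambda>(z, t). k (circ \<rho> t) * H (vupd z i (circ \<rho> t)))"
  unfolding case_prod_unfold
proof (intro continuous_intros)
  show "continuous_on (polydisc \<rho> \<times> S) (\<lambda>p. k (circ \<rho> (snd p)))"
    by (rule continuous_on_compose2[OF k])
      (use circ_in_sphere in \<open>auto intro!: continuous_on_compose2[OF continuous_on_circ[of UNIV]] continuous_intros\<close>)
  show "continuous_on (polydisc \<rho> \<times> S) (\<lambda>p. H (vupd (fst p) i (circ \<rho> (snd p))))"
    by (rule continuous_on_compose2[OF H])
      (use \<rho> in \<open>auto intro!: vupd_in_polydisc continuous_on_compose2[OF continuous_on_circ[of UNIV]] continuous_intros\<close>)
qed

lemma continuous_on_circle_mean_integrand1: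
  fixes H :: "complex ^ 'n \<Rightarrow> complex"
  assumes k: "continuous_on (sphere 0 \<rho>) k" and H: "continuous_on (polydisc \<rho>) H"
    and z: "z \<in> polydisc \<rho>"
  shows "continuous_on S (\<lambda>t. k (circ \<rho> t) * H (vupd z i (circ \<rho> t)))"
proof -
  have "continuous_on S (\<lambda>t. (\<lambda>(z, t). k (circ \<rho> t) * H (vupd z i (circ \<rho> t))) (z, t))"
    by (rule continuous_on_compose2[OF continuous_on_circle_mean_integrand[OF k H, of UNIV]])
      (use z in \<open>auto intro!: continuous_intros\<close>)
  then show ?thesis by simp
qed

lemmas circle_mean_integrable = integrable_continuous_real[OF continuous_on_circle_mean_integrand1]

lemma continuous_on_circle_mean:
  fixes H :: "complex ^ 'n \<Rightarrow> complex"
  assumes "continuous_on (sphere 0 \<rho>) k" "continuous_on (polydisc \<rho>) H"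
  shows "continuous_on (polydisc \<rho>) (circle_mean \<rho> i k H)"
  using integral_continuous_on_param[OF continuous_on_circle_mean_integrand[OF assms, of "cbox 0 1" i]]
  by (simp add: circle_mean_def[abs_def])

lemma circle_mean_add:
  fixes H :: "complex ^ 'n \<Rightarrow> complex"
  assumes "continuous_on (sphere 0 \<rho>) k" "continuous_on (polydisc \<rho>) H" "continuous_on (polydisc \<rho>) G"
    "z \<in> polydisc \<rho>"
  shows "circle_mean \<rho> i k (\<lambda>z. H z + G z) z = circle_mean \<rho> i k H z + circle_mean \<rho> i k G z"
  unfolding circle_mean_def distrib_left
  by (rule integral_add) (use assms circle_mean_integrable in blast)+

lemma circle_mean_scale:
  "circle_mean \<rho> i k (\<lambda>z. c * H z) z = c * circle_mean \<rho> i k H z"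
  unfolding circle_mean_def integral_mult_right[symmetric] by (simp add: mult.left_commute)

lemma norm_circle_mean_le:
  fixes H :: "complex ^ 'n \<Rightarrow> complex"
  assumes "continuous_on (sphere 0 \<rho>) k" "continuous_on (polydisc \<rho>) H" "z \<in> polydisc \<rho>"
    and K: "\<And>\<zeta>. \<zeta> \<in> sphere 0 \<rho> \<Longrightarrow> norm (k \<zeta>) \<le> K"
    and M: "\<And>z. z \<in> polydisc \<rho> \<Longrightarrow> norm (H z) \<le> M"
  shows "norm (circle_mean \<rho> i k H z) \<le> K * M"
proof -
  have "norm (k (circ \<rho> t) * H (vupd z i (circ \<rho> t))) \<le> K * M" for t
    unfolding norm_mult
    using K[OF circ_in_sphere[of t]] M[OF vupd_in_polydisc[OF assms(3), of "circ \<rho> t" i]] \<rho>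
    by (intro mult_mono) (auto intro: order_trans[OF norm_ge_zero])
  then have "norm (integral {0..1} (\<lambda>t. k (circ \<rho> t) * H (vupd z i (circ \<rho> t)))) \<le> K * M * (1 - 0)"
    by (intro integral_bound continuous_on_circle_mean_integrand1 assms) auto
  then show ?thesis by (simp add: circle_mean_def)
qed

text \<open>
  Fubini's theorem for two different coordinates.
\<close>

lemma circle_mean_commute:
  fixes H :: "complex ^ 'n \<Rightarrow> complex"
  assumes k: "continuous_on (sphere 0 \<rho>) k" and l: "continuous_on (sphere 0 \<rho>) l"
    and H: "continuous_on (polydisc \<rho>) H" and z: "z \<in> polydisc \<rho>" and ij: "i \<noteq> j"
  shows "circle_mean \<rho> i k (circle_mean \<rho> j l H) z = circle_mean \<rho> j l (circle_mean \<rho> i k H) z"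
proof -
  define F where "F s t = k (circ \<rho> s) * (l (circ \<rho> t) * H (vupd (vupd z i (circ \<rho> s)) j (circ \<rho> t)))"
    for s t
  have cont: "continuous_on (cbox (0, 0) (1, 1)) (\<lambda>(s, t). F s t)"
  proof -
    have "continuous_on (cbox (0, 0) (1, 1)) (\<lambda>p. k (circ \<rho> (fst p)))"
      by (rule continuous_on_compose2[OF k])
        (use circ_in_sphere in \<open>auto intro!: continuous_on_compose2[OF continuous_on_circ[of UNIV]] continuous_intros\<close>)
    moreover have "continuous_on (cbox (0, 0) (1, 1)) (\<lambda>p. l (circ \<rho> (snd p)))"
      by (rule continuous_on_compose2[OF l])
        (use circ_in_sphere in \<open>auto intro!: continuous_on_compose2[OF continuous_on_circ[of UNIV]] continuous_intros\<close>)
    moreover have "continuous_on (cbox (0, 0) (1, 1)) (\<lambda>p. H (vupd (vupd z i (circ \<rho> (fst p))) j (circ \<rho> (snd p))))"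
      by (rule continuous_on_compose2[OF H])
        (use \<rho> z in \<open>auto intro!: vupd_in_polydisc continuous_on_compose2[OF continuous_on_circ[of UNIV]] continuous_intros\<close>)
    ultimately show ?thesis
      unfolding F_def case_prod_unfold by (intro continuous_on_mult)
  qed
  have "circle_mean \<rho> i k (circle_mean \<rho> j l H) z = integral {0..1} (\<lambda>s. integral {0..1} (F s))"
    unfolding circle_mean_def F_def[abs_def] by simp
  also have "\<dots> = integral {0..1} (\<lambda>t. integral {0..1} (\<lambda>s. F s t))"
    using integral_swap_continuous[OF cont] by simp
  also have "\<dots> = circle_mean \<rho> j l (circle_mean \<rho> i k H) z"
    unfolding circle_mean_def F_def[abs_def] integral_mult_right[symmetric]
    by (simp add: vupd_commute[OF ij] mult.left_commute)
  finally show ?thesis .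
qed

lemma continuous_on_cauchy_kernel:
  "norm w < \<rho> \<Longrightarrow> continuous_on (sphere 0 \<rho>) (cauchy_kernel w)"
  unfolding cauchy_kernel_def by (intro continuous_intros) auto

lemma Cauchy_formula_circ:
  assumes "f holomorphic_on cball 0 \<rho>" "norm w < \<rho>"
  shows "integral {0..1} (\<lambda>t. cauchy_kernel w (circ \<rho> t) * f (circ \<rho> t)) = f w"
proof -
  have c: "circlepath 0 \<rho> t = circ \<rho> t" for t
    by (simp add: circlepath circ_def)
  have "((\<lambda>u. f u / (u - w)) has_contour_integral (2 * of_real pi * \<i> * f w)) (circlepath 0 \<rho>)"
    using Cauchy_integral_circlepath_simple[OF assms(1), of w] assms(2) by simp
  then have "((\<lambda>t. f (circ \<rho> t) / (circ \<rho> t - w) * vector_derivative (circlepath 0 \<rho>) (at t within {0..1}))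
      has_integral (2 * of_real pi * \<i> * f w)) {0..1}"
    by (simp add: has_contour_integral_def c)
  then have "((\<lambda>t. (2 * of_real pi * \<i>) * (cauchy_kernel w (circ \<rho> t) * f (circ \<rho> t)))
      has_integral (2 * of_real pi * \<i> * f w)) {0..1}"
    by (rule has_integral_eq[rotated])
      (simp add: vector_derivative_circlepath01 cauchy_kernel_def circ_def field_simps)
  from has_integral_mult_right[OF this, of "1 / (2 * of_real pi * \<i>)"]
  have "((\<lambda>t. cauchy_kernel w (circ \<rho> t) * f (circ \<rho> t)) has_integral f w) {0..1}"
    by simp
  then show ?thesis by (rule integral_unique)
qed

text \<open>
  In the coordinate \<open>i\<close> the mean is constant; in any other coordinate Cauchy's formula for \<open>H\<close> can be
  applied under the integral.
\<close>

lemma circle_mean_in_cauchy_class: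
  fixes H :: "complex ^ 'n \<Rightarrow> complex"
  assumes k: "continuous_on (sphere 0 \<rho>) k" and H: "H \<in> cauchy_class \<rho>"
  shows "circle_mean \<rho> i k H \<in> cauchy_class \<rho>"
  unfolding cauchy_class_def
proof (safe)
  have contH: "continuous_on (polydisc \<rho>) H" using H by (simp add: cauchy_class_def)
  show "continuous_on (polydisc \<rho>) (circle_mean \<rho> i k H)"
    by (rule continuous_on_circle_mean[OF k contH])
  fix j and z :: "complex ^ 'n" assume z: "z \<in> polydisc \<rho>" "norm (z $ j) < \<rho>"
  show "circle_mean \<rho> j (cauchy_kernel (z $ j)) (circle_mean \<rho> i k H) z = circle_mean \<rho> i k H z"
  proof (cases "j = i")
    case True
    have "circle_mean \<rho> i (cauchy_kernel (z $ i)) (circle_mean \<rho> i k H) z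
        = integral {0..1} (\<lambda>t. cauchy_kernel (z $ i) (circ \<rho> t) * circle_mean \<rho> i k H z)"
      by (simp add: circle_mean_def)
    also have "\<dots> = circle_mean \<rho> i k H z"
      using Cauchy_formula_circ[of "\<lambda>_. circle_mean \<rho> i k H z" "z $ i"] z(2) True by simp
    finally show ?thesis using True by simp
  next
    case False
    have "circle_mean \<rho> j (cauchy_kernel (z $ j)) (circle_mean \<rho> i k H) z
        = circle_mean \<rho> i k (circle_mean \<rho> j (cauchy_kernel (z $ j)) H) z"
      by (rule circle_mean_commute[OF continuous_on_cauchy_kernel[OF z(2)] k contH z(1) False])
    also have "\<dots> = circle_mean \<rho> i k H z"
      unfolding circle_mean_def[of \<rho> i]
    proof (intro integral_cong arg_cong2[where f = "(*)"] refl)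
      fix t
      have "vupd z i (circ \<rho> t) \<in> polydisc \<rho>" using z \<rho> by (intro vupd_in_polydisc) auto
      then show "circle_mean \<rho> j (cauchy_kernel (z $ j)) H (vupd z i (circ \<rho> t)) = H (vupd z i (circ \<rho> t))"
        using H z(2) vupd_simps(2)[OF False, of z "circ \<rho> t"]
        unfolding cauchy_class_def mem_Collect_eq by metis
    qed
    finally show ?thesis .
  qed
qed

lemma continuous_on_sphere_power_inverse:
  "continuous_on (sphere 0 \<rho>) (\<lambda>\<zeta>::complex. 1 / \<zeta> ^ a)"
  by (intro continuous_intros) (use \<rho> in auto)

lemma cauchy_kernel_expansion:
  assumes "\<zeta> \<noteq> 0" "\<zeta> \<noteq> w"
  shows "cauchy_kernel w \<zeta> = (\<Sum>a<m. w ^ a * (1 / \<zeta> ^ a)) + w ^ m * (1 / \<zeta> ^ m * cauchy_kernel w \<zeta>)"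
proof (induction m)
  case (Suc m)
  have "cauchy_kernel w \<zeta> = 1 + w / \<zeta> * cauchy_kernel w \<zeta>"
    using assms by (simp add: cauchy_kernel_def field_simps)
  then have "w ^ m * (1 / \<zeta> ^ m * cauchy_kernel w \<zeta>) =
      w ^ m * (1 / \<zeta> ^ m * (1 + w / \<zeta> * cauchy_kernel w \<zeta>))"
    by simp
  also have "\<dots> = w ^ m * (1 / \<zeta> ^ m) + w ^ Suc m * (1 / \<zeta> ^ Suc m * cauchy_kernel w \<zeta>)"
    by (simp add: distrib_left mult_ac)
  finally have "w ^ m * (1 / \<zeta> ^ m * cauchy_kernel w \<zeta>) =
      w ^ m * (1 / \<zeta> ^ m) + w ^ Suc m * (1 / \<zeta> ^ Suc m * cauchy_kernel w \<zeta>)" .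
  then show ?case using Suc.IH by (simp add: add.assoc)
qed simp

text \<open>
  Taylor expansion in the single coordinate \<open>i\<close>, with the expansion of the Cauchy kernel into a
  geometric sum. The coefficients are functions of the remaining coordinates.
\<close>

lemma partial_Taylor_remainder:
  fixes H :: "complex ^ 'n \<Rightarrow> complex"
  assumes H: "H \<in> cauchy_class \<rho>" and z: "z \<in> polydisc (\<rho> / 2)"
    and M: "\<And>z. z \<in> polydisc \<rho> \<Longrightarrow> norm (H z) \<le> M"
  shows "norm (H z - (\<Sum>a<m. (z $ i) ^ a * circle_mean \<rho> i (\<lambda>\<zeta>. 1 / \<zeta> ^ a) H z))
    \<le> norm (z $ i) ^ m * (2 / \<rho> ^ m * M)"
proof -
  define w where "w = z $ i"
  have zj: "norm (z $ j) \<le> \<rho> / 2" for j using z by (simp add: polydisc_def)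
  have w: "norm w \<le> \<rho> / 2" "norm w < \<rho>" using zj[of i] \<rho> by (simp_all add: w_def)
  have z': "z \<in> polydisc \<rho>"
    using z \<rho> polydisc_mono[of "\<rho> / 2" \<rho>] by auto
  have contH: "continuous_on (polydisc \<rho>) H" using H by (simp add: cauchy_class_def)
  note kc = continuous_on_sphere_power_inverse
  have kc': "continuous_on (sphere 0 \<rho>) (\<lambda>\<zeta>. 1 / \<zeta> ^ m * cauchy_kernel w \<zeta>)"
    by (intro continuous_on_mult kc continuous_on_cauchy_kernel w)
  let ?R = "circle_mean \<rho> i (\<lambda>\<zeta>. 1 / \<zeta> ^ m * cauchy_kernel w \<zeta>) H z"
  have "H z = circle_mean \<rho> i (cauchy_kernel w) H z"
    using H z' w by (auto simp: cauchy_class_def w_def)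
  also have "\<dots> = integral {0..1} (\<lambda>t.
      (\<Sum>a<m. w ^ a * (1 / circ \<rho> t ^ a * H (vupd z i (circ \<rho> t))))
      + w ^ m * (1 / circ \<rho> t ^ m * cauchy_kernel w (circ \<rho> t) * H (vupd z i (circ \<rho> t))))"
    unfolding circle_mean_def
  proof (rule integral_cong)
    fix t
    have "norm (circ \<rho> t) = \<rho>" using \<rho> by simp
    then have ne: "circ \<rho> t \<noteq> 0" "circ \<rho> t \<noteq> w" using w \<rho> by (metis norm_zero less_irrefl)+
    show "cauchy_kernel w (circ \<rho> t) * H (vupd z i (circ \<rho> t)) =
      (\<Sum>a<m. w ^ a * (1 / circ \<rho> t ^ a * H (vupd z i (circ \<rho> t))))
      + w ^ m * (1 / circ \<rho> t ^ m * cauchy_kernel w (circ \<rho> t) * H (vupd z i (circ \<rho> t)))"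
      by (subst cauchy_kernel_expansion[OF ne, of m])
        (simp add: distrib_right sum_distrib_right mult.assoc del: times_divide_eq_right times_divide_eq_left)
  qed
  also have "\<dots> = (\<Sum>a<m. w ^ a * circle_mean \<rho> i (\<lambda>\<zeta>. 1 / \<zeta> ^ a) H z) + w ^ m * ?R"
  proof -
    have int: "(\<lambda>t. w ^ a * (1 / circ \<rho> t ^ a * H (vupd z i (circ \<rho> t)))) integrable_on {0..1}" for a
      by (intro integrable_on_mult_right circle_mean_integrable[OF kc contH z'])
    have int': "(\<lambda>t. w ^ m * (1 / circ \<rho> t ^ m * cauchy_kernel w (circ \<rho> t) * H (vupd z i (circ \<rho> t))))
        integrable_on {0..1}"
      by (intro integrable_on_mult_right circle_mean_integrable[OF kc' contH z'])
    show ?thesis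
      by (subst integral_add, intro integrable_sum int, simp, rule int', subst integral_sum)
        (simp_all add: int circle_mean_def del: times_divide_eq_right times_divide_eq_left)
  qed
  finally have "H z - (\<Sum>a<m. w ^ a * circle_mean \<rho> i (\<lambda>\<zeta>. 1 / \<zeta> ^ a) H z) = w ^ m * ?R"
    by simp
  moreover have "norm ?R \<le> 2 / \<rho> ^ m * M"
  proof (rule norm_circle_mean_le[OF kc' contH z' _ M])
    fix \<zeta> :: complex assume "\<zeta> \<in> sphere 0 \<rho>"
    then have \<zeta>: "norm \<zeta> = \<rho>" by simp
    have "\<rho> / 2 \<le> norm (\<zeta> - w)" using norm_triangle_ineq2[of \<zeta> w] \<zeta> w by simp
    then have "norm (cauchy_kernel w \<zeta>) \<le> \<rho> / (\<rho> / 2)"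
      unfolding cauchy_kernel_def norm_divide \<zeta> using \<rho> by (intro divide_left_mono mult_pos_pos) auto
    then show "norm (1 / \<zeta> ^ m * cauchy_kernel w \<zeta>) \<le> 2 / \<rho> ^ m"
      using \<rho> \<zeta> by (simp add: norm_mult norm_divide norm_power divide_right_mono)
  qed
  ultimately show ?thesis
    unfolding w_def[symmetric] by (simp only: norm_mult norm_power) (intro mult_left_mono, auto)
qed

end

section \<open>Finitely many functionals that bound the order of vanishing\<close>

text \<open>
  Bounded linear functionals on the continuous functions on the closed polydisc. They are defined on
  all functions, but nothing is required about functions that are not continuous on the polydisc.
\<close>

definition polydisc_functional :: "real \<Rightarrow> ((complex ^ 'n \<Rightarrow> complex) \<Rightarrow> complex) \<Rightarrow> bool"
  where "polydisc_functional \<rho> \<Lambda> \<longleftrightarrow>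
    (\<forall>H G. continuous_on (polydisc \<rho>) H \<longrightarrow> continuous_on (polydisc \<rho>) G \<longrightarrow>
      \<Lambda> (\<lambda>z. H z + G z) = \<Lambda> H + \<Lambda> G) \<and>
    (\<forall>c H. continuous_on (polydisc \<rho>) H \<longrightarrow> \<Lambda> (\<lambda>z. c * H z) = c * \<Lambda> H) \<and>
    (\<exists>B\<ge>0. \<forall>H M. continuous_on (polydisc \<rho>) H \<longrightarrow> (\<forall>z\<in>polydisc \<rho>. norm (H z) \<le> M) \<longrightarrow>
      norm (\<Lambda> H) \<le> B * M)"

lemma polydisc_functional_cong:
  assumes \<Lambda>: "polydisc_functional \<rho> \<Lambda>"
    and cont: "continuous_on (polydisc \<rho>) H" "continuous_on (polydisc \<rho>) G"
    and eq: "\<And>z. z \<in> polydisc \<rho> \<Longrightarrow> H z = G z"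
  shows "\<Lambda> H = \<Lambda> G"
proof -
  have d: "continuous_on (polydisc \<rho>) (\<lambda>z. H z - G z)" using cont by (intro continuous_intros)
  from \<Lambda> obtain B where B: "\<forall>H M. continuous_on (polydisc \<rho>) H \<longrightarrow>
      (\<forall>z\<in>polydisc \<rho>. norm (H z) \<le> M) \<longrightarrow> norm (\<Lambda> H) \<le> B * M"
    unfolding polydisc_functional_def by blast
  have "norm (\<Lambda> (\<lambda>z. H z - G z)) \<le> B * 0"
    by (rule B[rule_format, OF d]) (simp add: eq)
  moreover have "\<Lambda> (\<lambda>z. (H z - G z) + G z) = \<Lambda> (\<lambda>z. H z - G z) + \<Lambda> G"
    using \<Lambda> d cont(2) unfolding polydisc_functional_def by blast
  ultimately show ?thesis by simp
qed

lemma polydisc_functional_circle_mean: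
  fixes \<Lambda> :: "(complex ^ 'n \<Rightarrow> complex) \<Rightarrow> complex"
  assumes \<Lambda>: "polydisc_functional \<rho> \<Lambda>" and \<rho>: "0 < \<rho>" and k: "continuous_on (sphere 0 \<rho>) k"
  shows "polydisc_functional \<rho> (\<lambda>H. \<Lambda> (circle_mean \<rho> i k H))"
  unfolding polydisc_functional_def
proof (intro conjI allI impI)
  note cont = continuous_on_circle_mean[OF \<rho> k]
  note \<Lambda>' = \<Lambda>[unfolded polydisc_functional_def]
  show "\<Lambda> (circle_mean \<rho> i k (\<lambda>z. H z + G z)) = \<Lambda> (circle_mean \<rho> i k H) + \<Lambda> (circle_mean \<rho> i k G)"
    if "continuous_on (polydisc \<rho>) H" "continuous_on (polydisc \<rho>) G" for H G
  proof -
    have "\<Lambda> (circle_mean \<rho> i k (\<lambda>z. H z + G z)) = \<Lambda> (\<lambda>z. circle_mean \<rho> i k H z + circle_mean \<rho> i k G z)"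
      by (rule polydisc_functional_cong[OF \<Lambda>])
        (use that in \<open>auto intro!: cont continuous_intros circle_mean_add[OF \<rho> k]\<close>)
    also have "\<dots> = \<Lambda> (circle_mean \<rho> i k H) + \<Lambda> (circle_mean \<rho> i k G)"
      using \<Lambda>' cont that by blast
    finally show ?thesis .
  qed
  show "\<Lambda> (circle_mean \<rho> i k (\<lambda>z. c * H z)) = c * \<Lambda> (circle_mean \<rho> i k H)"
    if "continuous_on (polydisc \<rho>) H" for c H
    unfolding circle_mean_scale[OF \<rho>, abs_def] using \<Lambda>' cont that by blast
  obtain B where B: "0 \<le> B" "\<And>H M. continuous_on (polydisc \<rho>) H \<Longrightarrow>
      (\<forall>z\<in>polydisc \<rho>. norm (H z) \<le> M) \<Longrightarrow> norm (\<Lambda> H) \<le> B * M"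
    using \<Lambda>' by blast
  have "compact (k ` sphere 0 \<rho>)" using k by (intro compact_continuous_image) auto
  from compact_imp_bounded[OF this] obtain K where K: "\<And>\<zeta>. \<zeta> \<in> sphere 0 \<rho> \<Longrightarrow> norm (k \<zeta>) \<le> K"
    unfolding bounded_iff by blast
  have K0: "0 \<le> K" using order_trans[OF norm_ge_zero K[OF circ_in_sphere[OF \<rho>, of 0]]] .
  show "\<exists>B\<ge>0. \<forall>H M. continuous_on (polydisc \<rho>) H \<longrightarrow> (\<forall>z\<in>polydisc \<rho>. norm (H z) \<le> M) \<longrightarrow>
      norm (\<Lambda> (circle_mean \<rho> i k H)) \<le> B * M"
  proof (intro exI[of _ "B * K"] conjI allI impI)
    fix H :: "complex ^ 'n \<Rightarrow> complex" and M
    assume H: "continuous_on (polydisc \<rho>) H" and M: "\<forall>z\<in>polydisc \<rho>. norm (H z) \<le> M"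
    have "\<forall>z\<in>polydisc \<rho>. norm (circle_mean \<rho> i k H z) \<le> K * M"
    proof
      fix z :: "complex ^ 'n" assume "z \<in> polydisc \<rho>"
      then show "norm (circle_mean \<rho> i k H z) \<le> K * M"
        by (rule norm_circle_mean_le[OF \<rho> k H _ K]) (use M in auto)
    qed
    from B(2)[OF cont[OF H] this] show "norm (\<Lambda> (circle_mean \<rho> i k H)) \<le> B * K * M"
      by (simp only: mult.assoc)
  qed (use B(1) K0 in simp)
qed

text \<open>
  Induction on the set of coordinates on which \<open>H\<close> depends. The Taylor coefficients of \<open>H\<close> in the new
  coordinate \<open>i\<close> up to order \<open>m\<close> no longer depend on \<open>i\<close>, so the induction hypothesis applies to them; the
  functionals of \<open>H\<close> are those of its coefficients. The result is a set of iterated Taylor coefficients,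
  with more mixed ones than the order \<open>m\<close> requires.
\<close>

lemma jets_determined_in_coordinates:
  fixes A :: "'n::finite set"
  assumes \<rho>: "0 < \<rho>" and A: "finite A"
  shows "\<exists>\<Phi>. finite \<Phi> \<and> (\<forall>\<Lambda>\<in>\<Phi>. polydisc_functional \<rho> \<Lambda>) \<and>
    (\<forall>H :: complex ^ 'n \<Rightarrow> complex. H \<in> cauchy_class \<rho> \<longrightarrow>
      (\<forall>z\<in>polydisc \<rho>. \<forall>w\<in>polydisc \<rho>. (\<forall>i\<in>A. z $ i = w $ i) \<longrightarrow> H z = H w) \<longrightarrow>
      (\<forall>\<Lambda>\<in>\<Phi>. \<Lambda> H = 0) \<longrightarrow>
      (\<exists>C. \<forall>z\<in>polydisc (\<rho> / 2). norm (H z) \<le> C * norm z ^ m))"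
  using A
proof (induction A rule: finite_induct)
  case empty
  have 0: "0 \<in> polydisc \<rho>" using \<rho> by (simp add: polydisc_def)
  have sub: "polydisc (\<rho> / 2) \<subseteq> polydisc \<rho>" using \<rho> by (intro polydisc_mono) simp
  have functional: "polydisc_functional \<rho> (\<lambda>H. H 0)"
    unfolding polydisc_functional_def
    by (intro conjI allI impI exI[of _ "1::real"]) (use 0 in auto)
  show ?case
  proof (intro exI[of _ "{\<lambda>H. H 0}"] conjI allI impI)
    fix H :: "complex ^ 'n \<Rightarrow> complex"
    assume const: "\<forall>z\<in>polydisc \<rho>. \<forall>w\<in>polydisc \<rho>. (\<forall>i\<in>{}. z $ i = w $ i) \<longrightarrow> H z = H w"
      and "\<forall>\<Lambda>\<in>{\<lambda>H. H 0}. \<Lambda> H = 0"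
    then have H0: "H 0 = 0" by simp
    have "H z = 0" if "z \<in> polydisc (\<rho> / 2)" for z
      using const[rule_format, OF subsetD[OF sub that] 0] H0 by simp
    then show "\<exists>C. \<forall>z\<in>polydisc (\<rho> / 2). norm (H z) \<le> C * norm z ^ m"
      by (intro exI[of _ 0]) auto
  qed (use functional in simp_all)
next
  case (insert i A)
  from insert.IH obtain \<Phi> where \<Phi>: "finite \<Phi>" "\<forall>\<Lambda>\<in>\<Phi>. polydisc_functional \<rho> \<Lambda>"
    "\<And>H :: complex ^ 'n \<Rightarrow> complex. H \<in> cauchy_class \<rho> \<Longrightarrow>
      (\<forall>z\<in>polydisc \<rho>. \<forall>w\<in>polydisc \<rho>. (\<forall>i\<in>A. z $ i = w $ i) \<longrightarrow> H z = H w) \<Longrightarrow>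
      (\<forall>\<Lambda>\<in>\<Phi>. \<Lambda> H = 0) \<Longrightarrow>
      (\<exists>C. \<forall>z\<in>polydisc (\<rho> / 2). norm (H z) \<le> C * norm z ^ m)"
    by (elim exE conjE) blast
  define Q where "Q a H = circle_mean \<rho> i (\<lambda>\<zeta>. 1 / \<zeta> ^ a) H" for a and H :: "complex ^ 'n \<Rightarrow> complex"
  note kc = continuous_on_sphere_power_inverse[OF \<rho>]
  let ?\<Psi> = "(\<lambda>(a, \<Lambda>) H. \<Lambda> (Q a H)) ` ({..<m} \<times> \<Phi>)"
  show ?case
  proof (intro exI[of _ ?\<Psi>] conjI allI impI)
    show "finite ?\<Psi>" using \<Phi>(1) by simp
    show "\<forall>\<Lambda>\<in>?\<Psi>. polydisc_functional \<rho> \<Lambda>"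
      using \<Phi>(2) polydisc_functional_circle_mean[OF _ \<rho> kc] by (auto simp: Q_def)
    fix H :: "complex ^ 'n \<Rightarrow> complex"
    assume H: "H \<in> cauchy_class \<rho>"
      and dep: "\<forall>z\<in>polydisc \<rho>. \<forall>w\<in>polydisc \<rho>. (\<forall>j\<in>insert i A. z $ j = w $ j) \<longrightarrow> H z = H w"
      and zero: "\<forall>\<Lambda>\<in>?\<Psi>. \<Lambda> H = 0"
    have "\<exists>C. \<forall>z\<in>polydisc (\<rho> / 2). norm (Q a H z) \<le> C * norm z ^ m" if "a < m" for a
    proof (rule \<Phi>(3))
      show "Q a H \<in> cauchy_class \<rho>"
        unfolding Q_def by (rule circle_mean_in_cauchy_class[OF \<rho> kc H])
      show "\<forall>\<Lambda>\<in>\<Phi>. \<Lambda> (Q a H) = 0" using zero that by auto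
      show "\<forall>z\<in>polydisc \<rho>. \<forall>w\<in>polydisc \<rho>. (\<forall>i\<in>A. z $ i = w $ i) \<longrightarrow> Q a H z = Q a H w"
      proof (intro ballI impI)
        fix z w :: "complex ^ 'n" assume *: "z \<in> polydisc \<rho>" "w \<in> polydisc \<rho>" "\<forall>i\<in>A. z $ i = w $ i"
        have "H (vupd z i (circ \<rho> t)) = H (vupd w i (circ \<rho> t))" for t
        proof -
          have "\<forall>j\<in>insert i A. vupd z i (circ \<rho> t) $ j = vupd w i (circ \<rho> t) $ j"
            using *(3) by (simp add: vupd_def)
          moreover have "vupd z i (circ \<rho> t) \<in> polydisc \<rho>" "vupd w i (circ \<rho> t) \<in> polydisc \<rho>"
            using * \<rho> by (auto intro: vupd_in_polydisc)
          ultimately show ?thesis using dep by blast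
        qed
        then show "Q a H z = Q a H w" by (simp add: Q_def circle_mean_def)
      qed
    qed
    then obtain C where C: "\<And>a z. a < m \<Longrightarrow> z \<in> polydisc (\<rho> / 2) \<Longrightarrow> norm (Q a H z) \<le> C a * norm z ^ m"
      by metis
    have "compact (H ` polydisc \<rho>)"
      using H by (intro compact_continuous_image compact_polydisc) (simp add: cauchy_class_def)
    from compact_imp_bounded[OF this] obtain M where M: "\<And>z. z \<in> polydisc \<rho> \<Longrightarrow> norm (H z) \<le> M"
      unfolding bounded_iff by blast
    have M0: "0 \<le> M"
      by (rule order_trans[OF norm_ge_zero M[of 0]]) (use \<rho> in \<open>simp add: polydisc_def\<close>)
    have "norm (H z) \<le> (2 / \<rho> ^ m * M + (\<Sum>a<m. (\<rho> / 2) ^ a * C a)) * norm z ^ m"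
      if z: "z \<in> polydisc (\<rho> / 2)" for z
    proof -
      have zi: "norm (z $ i) \<le> \<rho> / 2" using z by (simp add: polydisc_def)
      have "norm (H z) \<le> norm (H z - (\<Sum>a<m. (z $ i) ^ a * Q a H z)) + norm (\<Sum>a<m. (z $ i) ^ a * Q a H z)"
        by (simp add: norm_triangle_sub add.commute)
      also have "norm (H z - (\<Sum>a<m. (z $ i) ^ a * Q a H z)) \<le> norm (z $ i) ^ m * (2 / \<rho> ^ m * M)"
        unfolding Q_def by (rule partial_Taylor_remainder[OF \<rho> H z M])
      also have "\<dots> \<le> norm z ^ m * (2 / \<rho> ^ m * M)"
        using M0 \<rho> by (intro mult_right_mono power_mono Finite_Cartesian_Product.norm_nth_le) auto
      also have "norm (\<Sum>a<m. (z $ i) ^ a * Q a H z) \<le> (\<Sum>a<m. (\<rho> / 2) ^ a * (C a * norm z ^ m))"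
      proof (rule sum_norm_le)
        fix a assume "a \<in> {..<m}"
        then show "norm ((z $ i) ^ a * Q a H z) \<le> (\<rho> / 2) ^ a * (C a * norm z ^ m)"
          unfolding norm_mult norm_power using C[of a z] z zi \<rho>
          by (intro mult_mono power_mono) auto
      qed
      also have "norm z ^ m * (2 / \<rho> ^ m * M) + (\<Sum>a<m. (\<rho> / 2) ^ a * (C a * norm z ^ m))
          = (2 / \<rho> ^ m * M + (\<Sum>a<m. (\<rho> / 2) ^ a * C a)) * norm z ^ m"
        unfolding distrib_right sum_distrib_right by (simp only: mult_ac)
      finally show ?thesis by simp
    qed
    then show "\<exists>C. \<forall>z\<in>polydisc (\<rho> / 2). norm (H z) \<le> C * norm z ^ m" by blast
  qed
qed

lemma jets_finitely_determined:
  fixes m :: nat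
  assumes "0 < \<rho>"
  obtains \<Phi> :: "((complex ^ 'n \<Rightarrow> complex) \<Rightarrow> complex) set" where
    "finite \<Phi>" "\<And>\<Lambda>. \<Lambda> \<in> \<Phi> \<Longrightarrow> polydisc_functional \<rho> \<Lambda>"
    "\<And>H. H \<in> cauchy_class \<rho> \<Longrightarrow> (\<And>\<Lambda>. \<Lambda> \<in> \<Phi> \<Longrightarrow> \<Lambda> H = 0) \<Longrightarrow>
      \<exists>C. \<forall>z\<in>polydisc (\<rho> / 2). norm (H z) \<le> C * norm z ^ m"
proof -
  obtain \<Phi> :: "((complex ^ 'n \<Rightarrow> complex) \<Rightarrow> complex) set" where \<Phi>:
    "finite \<Phi>" "\<forall>\<Lambda>\<in>\<Phi>. polydisc_functional \<rho> \<Lambda>"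
    "\<forall>H. H \<in> cauchy_class \<rho> \<longrightarrow>
      (\<forall>z\<in>polydisc \<rho>. \<forall>w\<in>polydisc \<rho>. (\<forall>i\<in>UNIV. z $ i = w $ i) \<longrightarrow> H z = H w) \<longrightarrow>
      (\<forall>\<Lambda>\<in>\<Phi>. \<Lambda> H = 0) \<longrightarrow>
      (\<exists>C. \<forall>z\<in>polydisc (\<rho> / 2). norm (H z) \<le> C * norm z ^ m)"
    using jets_determined_in_coordinates[OF assms finite_class.finite_UNIV, of m, where 'n = 'n]
    by (elim exE conjE) blast
  have dep: "\<forall>z\<in>polydisc \<rho>. \<forall>w\<in>polydisc \<rho>. (\<forall>i\<in>UNIV. z $ i = w $ i) \<longrightarrow> H z = H w"
    for H :: "complex ^ 'n \<Rightarrow> complex"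
  proof (intro ballI impI)
    fix z w :: "complex ^ 'n" assume "\<forall>i\<in>UNIV. z $ i = w $ i"
    then have "z = w" by (simp add: vec_eq_iff)
    then show "H z = H w" by simp
  qed
  show thesis
    by (rule that[of \<Phi>]) (use \<Phi> dep in blast)+
qed

section \<open>Restriction to complex lines\<close>

lemma mv_holomorphic_on_line:
  assumes h: "mv_holomorphic_on h A" and line: "\<And>t. t \<in> \<Omega> \<Longrightarrow> w + t *s b \<in> A"
  shows "(\<lambda>t. h (w + t *s b)) holomorphic_on \<Omega>"
  unfolding holomorphic_on_def field_differentiable_def has_field_derivative_def
proof
  fix t assume t: "t \<in> \<Omega>"
  obtain c where c: "(h has_derivative (\<lambda>v. \<Sum>i\<in>UNIV. c $ i * v $ i)) (at (w + t *s b) within A)"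
    using h line[OF t] unfolding mv_holomorphic_on_def by blast
  have "linear (\<lambda>t. t *s b)"
    by (rule linearI) (simp_all add: vec_eq_iff algebra_simps)
  then have "((\<lambda>t. t *s b) has_derivative (\<lambda>t. t *s b)) (at t within \<Omega>)"
    by (intro bounded_linear_imp_has_derivative linear_conv_bounded_linear[THEN iffD1])
  then have "((\<lambda>t. w + t *s b) has_derivative (\<lambda>s. s *s b)) (at t within \<Omega>)"
    by (auto intro!: derivative_eq_intros)
  from has_derivative_in_compose[OF this has_derivative_subset[OF c]] line
  have "((\<lambda>t. h (w + t *s b)) has_derivative (\<lambda>s. \<Sum>i\<in>UNIV. c $ i * (s *s b) $ i)) (at t within \<Omega>)"
    by blast
  also have "(\<lambda>s. \<Sum>i\<in>UNIV. c $ i * (s *s b) $ i) = (*) (\<Sum>i\<in>UNIV. c $ i * b $ i)"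
    by (simp add: fun_eq_iff sum_distrib_left sum_distrib_right mult_ac)
  finally show "\<exists>f'. ((\<lambda>t. h (w + t *s b)) has_derivative (*) f') (at t within \<Omega>)" by blast
qed

lemma mv_holomorphic_on_imp_continuous_on: "mv_holomorphic_on h A \<Longrightarrow> continuous_on A h"
  unfolding mv_holomorphic_on_def continuous_on_eq_continuous_within
  using has_derivative_continuous by blast

lemma mv_holomorphic_on_subset:
  assumes "mv_holomorphic_on h A" "B \<subseteq> A"
  shows "mv_holomorphic_on h B"
  unfolding mv_holomorphic_on_def
proof
  fix z assume "z \<in> B"
  then obtain c where "(h has_derivative (\<lambda>v. \<Sum>i\<in>UNIV. c $ i * v $ i)) (at z within A)"
    using assms unfolding mv_holomorphic_on_def by blast
  from has_derivative_subset[OF this assms(2)]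
  show "\<exists>c. (h has_derivative (\<lambda>v. \<Sum>i\<in>UNIV. c $ i * v $ i)) (at z within B)" by blast
qed

text \<open>
  Charts take values in a subspace \<open>E\<close> of the coordinate space. Precomposition with a linear projection
  onto \<open>E\<close> turns functions on a part of \<open>E\<close> into functions on a polydisc of the full coordinate space.
\<close>

lemma linear_projection_matrix:
  fixes E :: "(complex ^ 'n) set"
  assumes "vec.subspace E"
  obtains M :: "complex ^ 'n ^ 'n" where "\<And>v. M *v v \<in> E" "\<And>v. v \<in> E \<Longrightarrow> M *v v = v"
proof -
  have "Vector_Spaces.linear (*s) (*s) (\<lambda>v :: complex ^ 'n. v)"
    by (simp add: Vector_Spaces.linear_iff vec.vector_space_axioms)
  from vec.linear_exists_left_inverse_on[OF this assms]
  obtain P where P: "range P \<subseteq> E" "Vector_Spaces.linear (*s) (*s) P" "\<forall>v\<in>E. P v = v"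
    by (auto simp: inj_on_def)
  show thesis
    by (rule that[of "matrix P"]) (use P matrix_works[OF P(2)] in auto)
qed

text \<open>
  A zero of finite order \<open>n\<close> is not \<open>O(norm t ^ Suc n)\<close>.
\<close>

lemma holomorphic_flat_imp_zero:
  assumes hol: "g holomorphic_on \<Omega>" and \<Omega>: "open \<Omega>" "connected \<Omega>" "0 \<in> \<Omega>"
    and flat: "\<And>m. \<exists>C. \<forall>\<^sub>F t in nhds 0. norm (g t) \<le> C * norm t ^ m"
    and t: "t \<in> \<Omega>"
  shows "g t = 0"
proof -
  obtain C where "\<forall>\<^sub>F t in nhds 0. norm (g t) \<le> C * norm t ^ 1" using flat[of 1] by blast
  from eventually_nhds_x_imp_x[OF this] have g0: "g 0 = 0" by simp
  show ?thesis
  proof (cases "g constant_on \<Omega>")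
    case True
    then show ?thesis using g0 \<Omega>(3) t unfolding constant_on_def by metis
  next
    case False
    obtain k r n where k: "0 < n" "0 < r" "ball 0 r \<subseteq> \<Omega>" "k holomorphic_on ball 0 r"
        "\<And>w. w \<in> ball 0 r \<Longrightarrow> g w = (w - 0) ^ n * k w" "\<And>w. w \<in> ball 0 r \<Longrightarrow> k w \<noteq> 0"
      by (rule holomorphic_factor_zero_nonconstant[OF hol \<Omega> g0 False], rule that) assumption+
    obtain C where C: "\<forall>\<^sub>F t in nhds 0. norm (g t) \<le> C * norm t ^ Suc n" using flat by blast
    have "\<forall>\<^sub>F w in at 0. norm (k w) \<le> C * norm w"
    proof -
      have "\<forall>\<^sub>F w in at 0. w \<in> ball 0 r" using k(2) by (intro eventually_at_in_open') auto
      moreover have "\<forall>\<^sub>F w in at 0. norm (g w) \<le> C * norm w ^ Suc n"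
        using C eventually_nhds_conv_at by blast
      moreover have "\<forall>\<^sub>F w in at 0. w \<noteq> (0::complex)" by (simp add: eventually_at_filter)
      ultimately show ?thesis
      proof eventually_elim
        case (elim w)
        have "norm (g w) = norm w ^ n * norm (k w)"
          using k(5)[OF elim(1)] by (simp add: norm_mult norm_power)
        moreover have "C * norm w ^ Suc n = norm w ^ n * (C * norm w)" by simp
        ultimately have "norm w ^ n * norm (k w) \<le> norm w ^ n * (C * norm w)"
          using elim(2) by metis
        moreover have "0 < norm w ^ n" using elim(3) by simp
        ultimately show ?case by (simp only: mult_le_cancel_left_pos)
      qed
    qed
    moreover have "isCont k 0"
      using holomorphic_on_imp_continuous_on[OF k(4)] k(2) by (simp add: continuous_on_eq_continuous_at)
    then have "((\<lambda>w. norm (k w)) \<longlongrightarrow> norm (k 0)) (at 0)"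
      unfolding isCont_def by (rule tendsto_norm)
    moreover have "((\<lambda>w::complex. C * norm w) \<longlongrightarrow> C * norm (0::complex)) (at 0)"
      by (intro tendsto_mult_left) (rule tendsto_norm[OF tendsto_ident_at])
    ultimately have "norm (k 0) \<le> C * norm (0::complex)"
      using tendsto_le[OF trivial_limit_at] by blast
    then show ?thesis using k(2) k(6)[of 0] by simp
  qed
qed

text \<open>
  The complex line through \<open>a\<close> and \<open>w\<close> meets the ball in a convex, hence connected, set, so that the
  statement in one variable applies along this line.
\<close>

lemma mv_holomorphic_flat_imp_zero:
  fixes E :: "(complex ^ 'n) set"
  assumes E: "vec.subspace E" and g: "mv_holomorphic_on g (ball z0 r \<inter> E)"
    and a: "a \<in> ball z0 r \<inter> E"
    and flat: "\<And>m. \<exists>C. \<exists>\<epsilon>>0. \<forall>w\<in>ball z0 r \<inter> E. norm (w - a) < \<epsilon> \<longrightarrow> norm (g w) \<le> C * norm (w - a) ^ m"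
    and w: "w \<in> ball z0 r \<inter> E"
  shows "g w = 0"
proof -
  define b where "b = w - a"
  define \<Omega> where "\<Omega> = (\<lambda>t. a + t *s b) -` ball z0 r"
  have b: "b \<in> E" using E a w by (simp add: b_def vec.subspace_diff)
  have lin: "linear (\<lambda>t. t *s b)"
    by (rule linearI) (simp_all add: vec_eq_iff algebra_simps)
  have cont: "continuous_on UNIV (\<lambda>t. a + t *s b)"
    by (intro continuous_intros linear_continuous_on linear_conv_bounded_linear[THEN iffD1] lin)
  have "open \<Omega>" unfolding \<Omega>_def by (rule open_vimage[OF open_ball cont])
  have "convex \<Omega>"
  proof -
    have "\<Omega> = (\<lambda>t. t *s b) -` ((\<lambda>v. v - a) ` ball z0 r)"
      by (force simp: \<Omega>_def image_iff algebra_simps)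
    then show ?thesis using lin by (simp add: convex_linear_vimage convex_translation_subtract)
  qed
  have \<Omega>: "0 \<in> \<Omega>" "1 \<in> \<Omega>" using a w by (simp_all add: \<Omega>_def b_def)
  have line: "a + t *s b \<in> ball z0 r \<inter> E" if "t \<in> \<Omega>" for t
    using that a b E by (auto simp: \<Omega>_def intro: vec.subspace_add vec.subspace_scale)
  have norm_b: "norm (t *s b) \<le> norm t * (\<Sum>i\<in>UNIV. norm (b $ i))" for t
    using norm_le_sum_components[of "t *s b"] by (simp add: norm_mult sum_distrib_left)
  have flat_line: "\<exists>C. \<forall>\<^sub>F t in nhds 0. norm (g (a + t *s b)) \<le> C * norm t ^ m" for m
  proof -
    obtain C \<epsilon> where C: "0 < \<epsilon>"
      "\<And>w. w \<in> ball z0 r \<inter> E \<Longrightarrow> norm (w - a) < \<epsilon> \<Longrightarrow> norm (g w) \<le> C * norm (w - a) ^ m"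
      using flat[of m] by blast
    have "open ((\<lambda>t. a + t *s b) -` ball a \<epsilon>)" by (rule open_vimage[OF open_ball cont])
    then have "\<forall>\<^sub>F t in nhds 0. t \<in> (\<lambda>t. a + t *s b) -` ball a \<epsilon>"
      by (rule eventually_nhds_in_open) (use C(1) in simp)
    moreover have "\<forall>\<^sub>F t in nhds 0. t \<in> \<Omega>" using \<open>open \<Omega>\<close> \<Omega>(1) by (rule eventually_nhds_in_open)
    ultimately have "\<forall>\<^sub>F t in nhds 0. norm (g (a + t *s b)) \<le>
        (\<bar>C\<bar> * (\<Sum>i\<in>UNIV. norm (b $ i)) ^ m) * norm t ^ m"
    proof eventually_elim
      case (elim t)
      then have "norm (t *s b) < \<epsilon>" by (simp add: dist_norm norm_minus_commute)
      then have "norm (g (a + t *s b)) \<le> C * norm (t *s b) ^ m" using C(2)[OF line] elim by simp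
      also have "\<dots> \<le> \<bar>C\<bar> * (norm t * (\<Sum>i\<in>UNIV. norm (b $ i))) ^ m"
        by (intro mult_mono power_mono norm_b) auto
      finally show ?case by (simp add: power_mult_distrib mult_ac)
    qed
    then show ?thesis by blast
  qed
  have "g (a + 1 *s b) = 0"
    by (rule holomorphic_flat_imp_zero[OF mv_holomorphic_on_line[OF g line] \<open>open \<Omega>\<close>
          convex_connected[OF \<open>convex \<Omega>\<close>] \<Omega>(1) flat_line \<Omega>(2)])
  then show ?thesis by (simp add: b_def)
qed

section \<open>Orders of vanishing on a manifold\<close>

definition vanishes_to_order ::
    "('a::topological_space \<Rightarrow> complex ^ 'n) \<Rightarrow> 'a \<Rightarrow> nat \<Rightarrow> ('a \<Rightarrow> complex) \<Rightarrow> bool"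
  where "vanishes_to_order \<phi> q m h \<longleftrightarrow>
    (\<exists>C. \<forall>\<^sub>F x in nhds q. norm (h x) \<le> C * norm (\<phi> x - \<phi> q) ^ m)"

text \<open>
  Linear functionals on a space \<open>V\<close> of functions that are continuous for uniform convergence on compact
  sets.
\<close>

definition compactly_bounded_functional ::
    "('a::topological_space \<Rightarrow> complex) set \<Rightarrow> (('a \<Rightarrow> complex) \<Rightarrow> complex) \<Rightarrow> bool"
  where "compactly_bounded_functional V l \<longleftrightarrow>
    (\<forall>h\<in>V. \<forall>g\<in>V. l (\<lambda>x. h x + g x) = l h + l g) \<and>
    (\<forall>c. \<forall>h\<in>V. l (\<lambda>x. c * h x) = c * l h) \<and>
    (\<exists>K B. compact K \<and> 0 \<le> B \<and>
      (\<forall>h\<in>V. \<forall>M. (\<forall>x\<in>K. norm (h x) \<le> M) \<longrightarrow> norm (l h) \<le> B * M))"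

lemma compactly_bounded_functional_subset:
  assumes l: "compactly_bounded_functional V l" and "W \<subseteq> V"
  shows "compactly_bounded_functional W l"
proof -
  note sub = subsetD[OF assms(2)]
  obtain K B where "compact K" "0 \<le> B"
    "\<And>h M. h \<in> V \<Longrightarrow> (\<forall>x\<in>K. norm (h x) \<le> M) \<Longrightarrow> norm (l h) \<le> B * M"
    using l[unfolded compactly_bounded_functional_def, THEN conjunct2, THEN conjunct2] by blast
  then have "\<exists>K B. compact K \<and> 0 \<le> B \<and>
      (\<forall>h\<in>W. \<forall>M. (\<forall>x\<in>K. norm (h x) \<le> M) \<longrightarrow> norm (l h) \<le> B * M)"
    using sub by (intro exI[of _ K] exI[of _ B]) simp
  then show ?thesis
    using l sub unfolding compactly_bounded_functional_def by (intro conjI) simp_all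
qed

context
  fixes E :: "(complex ^ 'n) set"
    and \<A> :: "('a :: {t2_space, second_countable_topology}, 'n) chart set"
  assumes manifold: "complex_manifold E \<A>"
begin

lemmas manifold_facts = manifold[unfolded complex_manifold_def]

lemma subspace_E: "vec.subspace E"
  by (rule manifold_facts[THEN conjunct1])

lemma chart_at: obtains U \<phi> where "(U, \<phi>) \<in> \<A>" "q \<in> U"
proof -
  have "q \<in> (\<Union>(U, \<phi>)\<in>\<A>. U)"
    unfolding manifold_facts[THEN conjunct2, THEN conjunct1] by simp
  then show thesis using that by blast
qed

context
  fixes U \<phi> assumes chart: "(U, \<phi>) \<in> \<A>"
begin

lemma chart_facts:
  "open U" "openin (top_of_set E) (\<phi> ` U)" "homeomorphism U (\<phi> ` U) \<phi> (inv_into U \<phi>)"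
  using bspec[OF manifold_facts[THEN conjunct2, THEN conjunct2, THEN conjunct1] chart] by simp_all

lemma chart_continuous: "continuous_on U \<phi>" "continuous_on (\<phi> ` U) (inv_into U \<phi>)"
  using chart_facts(3) by (auto simp: homeomorphism_def)

lemma chart_inverse: "x \<in> U \<Longrightarrow> inv_into U \<phi> (\<phi> x) = x"
  using chart_facts(3) by (auto simp: homeomorphism_def)

lemma chart_image_subset: "\<phi> ` U \<subseteq> E"
  using chart_facts(2) openin_imp_subset by blast

lemma eventually_in_chart:
  assumes "q \<in> U" "open S" "\<phi> q \<in> S"
  shows "\<forall>\<^sub>F x in nhds q. x \<in> U \<and> \<phi> x \<in> S"
proof -
  have "open (U \<inter> \<phi> -` S)"
    using continuous_open_preimage[OF chart_continuous(1) chart_facts(1) assms(2)] .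
  then have "\<forall>\<^sub>F x in nhds q. x \<in> U \<inter> \<phi> -` S" by (rule eventually_nhds_in_open) (use assms in simp)
  then show ?thesis by simp
qed

lemma holomorphic_in_chart:
  "h \<in> holomorphic_functions \<A> \<Longrightarrow> mv_holomorphic_on (\<lambda>z. h (inv_into U \<phi> z)) (\<phi> ` U)"
  using chart by (auto simp: holomorphic_functions_def)

lemma holomorphic_imp_continuous_on_chart:
  assumes "h \<in> holomorphic_functions \<A>"
  shows "continuous_on U h"
proof -
  have "continuous_on U (\<lambda>x. h (inv_into U \<phi> (\<phi> x)))"
    by (rule continuous_on_compose2[OF mv_holomorphic_on_imp_continuous_on[OF holomorphic_in_chart[OF assms]]
          chart_continuous(1)]) auto
  then show ?thesis by (rule continuous_on_eq) (simp add: chart_inverse)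
qed

text \<open>
  The map \<open>\<theta>\<close> is the inverse of the chart, centred at \<open>q\<close> and precomposed with a projection onto \<open>E\<close>. It
  is defined on a whole polydisc and inverts the centred chart near \<open>q\<close>, although it is not injective
  unless \<open>E\<close> is the full space.
\<close>

lemma polydisc_coordinates:
  assumes q: "q \<in> U"
  obtains \<theta> :: "complex ^ 'n \<Rightarrow> 'a" and \<rho> where "0 < \<rho>" "continuous_on (polydisc \<rho>) \<theta>"
    "\<And>h. h \<in> holomorphic_functions \<A> \<Longrightarrow> (\<lambda>z. h (\<theta> z)) \<in> cauchy_class \<rho>"
    "\<forall>\<^sub>F x in nhds q. \<theta> (\<phi> x - \<phi> q) = x"
proof -
  obtain M :: "complex ^ 'n ^ 'n" where M: "\<And>v. M *v v \<in> E" "\<And>v. v \<in> E \<Longrightarrow> M *v v = v"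
    using linear_projection_matrix[OF subspace_E] by blast
  define \<alpha> where "\<alpha> z = \<phi> q + M *v z" for z
  have linM: "linear ((*v) M)"
    by (rule linearI)
      (simp_all add: matrix_vector_mult_def vec_eq_iff distrib_left sum.distrib scaleR_right.sum)
  have cont_\<alpha>: "continuous_on S \<alpha>" for S
    unfolding \<alpha>_def
    by (intro continuous_intros linear_continuous_on linear_conv_bounded_linear[THEN iffD1] linM)
  have q': "\<phi> q \<in> \<phi> ` U" "\<phi> q \<in> E" using q chart_image_subset by auto
  obtain r where r: "0 < r" "ball (\<phi> q) r \<inter> E \<subseteq> \<phi> ` U"
    using chart_facts(2) q'(1) by (meson openin_contains_ball)
  have "open (\<alpha> -` ball (\<phi> q) r)" by (rule open_vimage[OF open_ball cont_\<alpha>])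
  moreover have "0 \<in> \<alpha> -` ball (\<phi> q) r" using r(1) by (simp add: \<alpha>_def)
  ultimately obtain \<delta> where \<delta>: "0 < \<delta>" "ball 0 \<delta> \<subseteq> \<alpha> -` ball (\<phi> q) r"
    by (meson openE)
  \<comment> \<open>A vector with components of size at most \<open>2 \<rho>\<close> has norm at most \<open>\<delta> / 2\<close>.\<close>
  define \<rho> where "\<rho> = \<delta> / (4 * of_nat CARD('n))"
  have \<rho>: "0 < \<rho>" using \<delta>(1) by (simp add: \<rho>_def)
  have \<alpha>_in: "\<alpha> z \<in> \<phi> ` U" if "z \<in> polydisc (2 * \<rho>)" for z
  proof -
    have "norm z \<le> of_nat CARD('n) * (2 * \<rho>)" by (rule norm_le_polydisc[OF that])
    also have "\<dots> = \<delta> / 2" by (simp add: \<rho>_def)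
    also have "\<dots> < \<delta>" using \<delta>(1) by simp
    finally have "\<alpha> z \<in> ball (\<phi> q) r" using \<delta>(2) by auto
    moreover have "\<alpha> z \<in> E" using M(1) q'(2) subspace_E by (simp add: \<alpha>_def vec.subspace_add)
    ultimately show ?thesis using r(2) by blast
  qed
  have \<alpha>_in': "\<alpha> z \<in> \<phi> ` U" if "z \<in> polydisc \<rho>" for z
    using \<alpha>_in polydisc_mono[of \<rho> "2 * \<rho>"] \<rho> that by auto
  define \<theta> where "\<theta> z = inv_into U \<phi> (\<alpha> z)" for z
  show thesis
  proof (rule that[of \<rho> \<theta>])
    show "continuous_on (polydisc \<rho>) \<theta>"
      unfolding \<theta>_def by (rule continuous_on_compose2[OF chart_continuous(2) cont_\<alpha>]) (use \<alpha>_in' in blast)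
    show "\<forall>\<^sub>F x in nhds q. \<theta> (\<phi> x - \<phi> q) = x"
    proof (rule eventually_mono[OF eventually_in_chart[OF q open_UNIV]])
      fix x assume x: "x \<in> U \<and> \<phi> x \<in> UNIV"
      then have "M *v (\<phi> x - \<phi> q) = \<phi> x - \<phi> q"
        using chart_image_subset q'(2) by (intro M(2) vec.subspace_diff[OF subspace_E]) auto
      then show "\<theta> (\<phi> x - \<phi> q) = x" using x by (simp add: \<theta>_def \<alpha>_def chart_inverse)
    qed simp
    fix h assume h: "h \<in> holomorphic_functions \<A>"
    note hol = holomorphic_in_chart[OF h]
    have "continuous_on (polydisc \<rho>) (\<lambda>z. h (\<theta> z))"
      unfolding \<theta>_def
      by (rule continuous_on_compose2[OF mv_holomorphic_on_imp_continuous_on[OF hol] cont_\<alpha>])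
        (use \<alpha>_in' in blast)
    moreover have "circle_mean \<rho> i (cauchy_kernel (z $ i)) (\<lambda>z. h (\<theta> z)) z = h (\<theta> z)"
      if z: "z \<in> polydisc \<rho>" "norm (z $ i) < \<rho>" for i and z :: "complex ^ 'n"
    proof -
      define b where "b = M *v axis i 1"
      have \<alpha>_vupd: "\<alpha> (vupd z i \<zeta>) = \<alpha> (vupd z i 0) + \<zeta> *s b" for \<zeta>
      proof -
        have "vupd z i \<zeta> = vupd z i 0 + \<zeta> *s axis i 1"
          by (simp add: vupd_def vec_eq_iff axis_def)
        then show ?thesis
          by (simp add: \<alpha>_def b_def matrix_vector_right_distrib vector_scalar_commute)
      qed
      have "(\<lambda>\<zeta>. h (inv_into U \<phi> (\<alpha> (vupd z i 0) + \<zeta> *s b))) holomorphic_on cball 0 \<rho>"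
      proof (rule mv_holomorphic_on_line[OF hol])
        fix \<zeta> :: complex assume "\<zeta> \<in> cball 0 \<rho>"
        then have "vupd z i \<zeta> \<in> polydisc \<rho>" using z by (intro vupd_in_polydisc) auto
        then show "\<alpha> (vupd z i 0) + \<zeta> *s b \<in> \<phi> ` U" using \<alpha>_in' \<alpha>_vupd by metis
      qed
      then have "(\<lambda>\<zeta>. h (\<theta> (vupd z i \<zeta>))) holomorphic_on cball 0 \<rho>"
        by (simp add: \<theta>_def \<alpha>_vupd[symmetric])
      from Cauchy_formula_circ[OF \<rho> this z(2)] show ?thesis
        by (simp add: circle_mean_def)
    qed
    ultimately show "(\<lambda>z. h (\<theta> z)) \<in> cauchy_class \<rho>"
      by (simp add: cauchy_class_def)
  qed (rule \<rho>)
qed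

lemma vanishing_order_finitely_determined:
  assumes q: "q \<in> U"
  obtains \<Phi> where "finite \<Phi>"
    "\<And>l. l \<in> \<Phi> \<Longrightarrow> compactly_bounded_functional (holomorphic_functions \<A>) l"
    "\<And>h. h \<in> holomorphic_functions \<A> \<Longrightarrow> (\<And>l. l \<in> \<Phi> \<Longrightarrow> l h = 0) \<Longrightarrow> vanishes_to_order \<phi> q m h"
proof -
  obtain \<theta> :: "complex ^ 'n \<Rightarrow> 'a" and \<rho> where \<rho>: "0 < \<rho>" and \<theta>: "continuous_on (polydisc \<rho>) \<theta>"
    and pull: "\<And>h. h \<in> holomorphic_functions \<A> \<Longrightarrow> (\<lambda>z. h (\<theta> z)) \<in> cauchy_class \<rho>"
    and inv: "\<forall>\<^sub>F x in nhds q. \<theta> (\<phi> x - \<phi> q) = x"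
    by (rule polydisc_coordinates[OF q], rule that)
  obtain \<Psi> :: "((complex ^ 'n \<Rightarrow> complex) \<Rightarrow> complex) set" where \<Psi>:
    "finite \<Psi>" "\<And>\<Lambda>. \<Lambda> \<in> \<Psi> \<Longrightarrow> polydisc_functional \<rho> \<Lambda>"
    "\<And>H. H \<in> cauchy_class \<rho> \<Longrightarrow> (\<And>\<Lambda>. \<Lambda> \<in> \<Psi> \<Longrightarrow> \<Lambda> H = 0) \<Longrightarrow>
      \<exists>C. \<forall>z\<in>polydisc (\<rho> / 2). norm (H z) \<le> C * norm z ^ m"
    by (rule jets_finitely_determined[OF \<rho>, of m, where 'n = 'n], rule that; blast)
  have cont: "continuous_on (polydisc \<rho>) (\<lambda>z. h (\<theta> z))" if "h \<in> holomorphic_functions \<A>" for h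
    using pull[OF that] by (simp add: cauchy_class_def)
  show thesis
  proof (rule that[of "(\<lambda>\<Lambda> h. \<Lambda> (\<lambda>z. h (\<theta> z))) ` \<Psi>"])
    show "finite ((\<lambda>\<Lambda> h. \<Lambda> (\<lambda>z. h (\<theta> z))) ` \<Psi>)" using \<Psi>(1) by simp
    show "compactly_bounded_functional (holomorphic_functions \<A>) l"
      if "l \<in> (\<lambda>\<Lambda> h. \<Lambda> (\<lambda>z. h (\<theta> z))) ` \<Psi>" for l
    proof -
      obtain \<Lambda> where \<Lambda>: "\<Lambda> \<in> \<Psi>" "l = (\<lambda>h. \<Lambda> (\<lambda>z. h (\<theta> z)))" using \<open>l \<in> _\<close> by blast
      note p = \<Psi>(2)[OF \<Lambda>(1), unfolded polydisc_functional_def]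
      obtain B where B: "0 \<le> B" "\<And>H M. continuous_on (polydisc \<rho>) H \<Longrightarrow>
          (\<forall>z\<in>polydisc \<rho>. norm (H z) \<le> M) \<Longrightarrow> norm (\<Lambda> H) \<le> B * M"
        using p[THEN conjunct2, THEN conjunct2] by blast
      have "compact (\<theta> ` polydisc \<rho>)" by (rule compact_continuous_image[OF \<theta> compact_polydisc])
      moreover have "norm (l h) \<le> B * M" if "h \<in> holomorphic_functions \<A>" "\<forall>x\<in>\<theta> ` polydisc \<rho>. norm (h x) \<le> M" for h M
        unfolding \<Lambda>(2) using that by (intro B(2) cont) auto
      ultimately have "\<exists>K B. compact K \<and> 0 \<le> B \<and> (\<forall>h\<in>holomorphic_functions \<A>. \<forall>M.
          (\<forall>x\<in>K. norm (h x) \<le> M) \<longrightarrow> norm (l h) \<le> B * M)" using B(1) by blast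
      moreover have "l (\<lambda>x. h x + g x) = l h + l g"
        if "h \<in> holomorphic_functions \<A>" "g \<in> holomorphic_functions \<A>" for h g
        unfolding \<Lambda>(2) by (rule p[THEN conjunct1, rule_format, OF cont[OF that(1)] cont[OF that(2)]])
      moreover have "l (\<lambda>x. c * h x) = c * l h" if "h \<in> holomorphic_functions \<A>" for c h
        unfolding \<Lambda>(2) by (rule p[THEN conjunct2, THEN conjunct1, rule_format, OF cont[OF that]])
      ultimately show ?thesis unfolding compactly_bounded_functional_def by (intro conjI ballI allI)
    qed
    fix h assume h: "h \<in> holomorphic_functions \<A>"
      and zero: "\<And>l. l \<in> (\<lambda>\<Lambda> h. \<Lambda> (\<lambda>z. h (\<theta> z))) ` \<Psi> \<Longrightarrow> l h = 0"
    have "\<exists>C. \<forall>z\<in>polydisc (\<rho> / 2). norm (h (\<theta> z)) \<le> C * norm z ^ m"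
      by (rule \<Psi>(3)[OF pull[OF h]]) (use zero in blast)
    then obtain C where C: "\<And>z. z \<in> polydisc (\<rho> / 2) \<Longrightarrow> norm (h (\<theta> z)) \<le> C * norm z ^ m" by blast
    have "\<forall>\<^sub>F x in nhds q. x \<in> U \<and> \<phi> x \<in> ball (\<phi> q) (\<rho> / 2)"
      using \<rho> by (intro eventually_in_chart[OF q]) auto
    with inv have "\<forall>\<^sub>F x in nhds q. norm (h x) \<le> C * norm (\<phi> x - \<phi> q) ^ m"
    proof eventually_elim
      case (elim x)
      have "norm ((\<phi> x - \<phi> q) $ i) \<le> \<rho> / 2" for i
        using Finite_Cartesian_Product.norm_nth_le[of "\<phi> x - \<phi> q" i] elim(2) by (simp add: dist_norm norm_minus_commute)
      then have "\<phi> x - \<phi> q \<in> polydisc (\<rho> / 2)" by (simp add: polydisc_def)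
      from C[OF this] show ?case by (simp add: elim(1))
    qed
    then show "vanishes_to_order \<phi> q m h" unfolding vanishes_to_order_def by blast
  qed
qed

text \<open>
  The set \<open>N\<close> corresponds to a ball in the chart. It serves every point \<open>y\<close> of flatness in it, not just
  its centre: for the closedness argument of the identity theorem, \<open>y\<close> has to vary while \<open>N\<close> stays fixed.
\<close>

lemma flat_imp_locally_zero:
  assumes x: "x \<in> U" and h: "h \<in> holomorphic_functions \<A>"
  obtains N where "open N" "x \<in> N" "N \<subseteq> U"
    "\<forall>y\<in>N. (\<forall>m. vanishes_to_order \<phi> y m h) \<longrightarrow> (\<forall>x\<in>N. h x = 0)"
proof -
  obtain r where r: "0 < r" "ball (\<phi> x) r \<inter> E \<subseteq> \<phi> ` U"
    using chart_facts(2) x by (meson openin_contains_ball imageI)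
  define N where "N = U \<inter> \<phi> -` ball (\<phi> x) r"
  have "open N"
    unfolding N_def by (rule continuous_open_preimage[OF chart_continuous(1) chart_facts(1) open_ball])
  have N_image: "\<phi> y \<in> ball (\<phi> x) r \<inter> E" if "y \<in> N" for y
    using that chart_image_subset by (auto simp: N_def)
  define g where "g z = h (inv_into U \<phi> z)" for z
  have g: "mv_holomorphic_on g (ball (\<phi> x) r \<inter> E)"
    unfolding g_def by (rule mv_holomorphic_on_subset[OF holomorphic_in_chart[OF h] r(2)])
  show thesis
  proof (rule that[of N])
    show "open N" by fact
    show "x \<in> N" "N \<subseteq> U" using x r(1) by (auto simp: N_def)
    show "\<forall>y\<in>N. (\<forall>m. vanishes_to_order \<phi> y m h) \<longrightarrow> (\<forall>x\<in>N. h x = 0)"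
    proof (intro ballI allI impI)
      fix y z assume y: "y \<in> N" and flat: "\<forall>m. vanishes_to_order \<phi> y m h" and z: "z \<in> N"
      have yU: "y \<in> U" using y by (simp add: N_def)
      have "\<exists>C. \<exists>\<epsilon>>0. \<forall>w\<in>ball (\<phi> x) r \<inter> E. norm (w - \<phi> y) < \<epsilon> \<longrightarrow> norm (g w) \<le> C * norm (w - \<phi> y) ^ m" for m
      proof -
        obtain C S where S: "open S" "y \<in> S" "\<And>x. x \<in> S \<Longrightarrow> norm (h x) \<le> C * norm (\<phi> x - \<phi> y) ^ m"
          using spec[OF flat, of m] unfolding vanishes_to_order_def eventually_nhds by blast
        have "\<exists>A. open A \<and> \<phi> y \<in> A \<and> (\<forall>w\<in>\<phi> ` U. w \<in> A \<longrightarrow> inv_into U \<phi> w \<in> S)"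
          using chart_continuous(2) S(1,2) yU chart_inverse[OF yU]
          unfolding continuous_on_topological by (metis imageI)
        then obtain A where A: "open A" "\<phi> y \<in> A" "\<And>w. w \<in> \<phi> ` U \<Longrightarrow> w \<in> A \<Longrightarrow> inv_into U \<phi> w \<in> S" by blast
        obtain \<epsilon> where \<epsilon>: "0 < \<epsilon>" "ball (\<phi> y) \<epsilon> \<subseteq> A" using A(1,2) by (meson openE)
        have "norm (g w) \<le> C * norm (w - \<phi> y) ^ m"
          if "w \<in> ball (\<phi> x) r \<inter> E" "norm (w - \<phi> y) < \<epsilon>" for w
        proof -
          have w: "w \<in> \<phi> ` U" using that(1) r(2) by blast
          have "w \<in> A" using that(2) \<epsilon>(2) by (auto simp: dist_norm norm_minus_commute)
          from S(3)[OF A(3)[OF w this]] show ?thesis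
            using w by (simp add: g_def f_inv_into_f)
        qed
        then show ?thesis using \<epsilon>(1) by blast
      qed
      from mv_holomorphic_flat_imp_zero[OF subspace_E g N_image[OF y] this]
      have "g (\<phi> z) = 0" using N_image[OF z] by blast
      moreover have "z \<in> U" using z by (simp add: N_def)
      ultimately show "h z = 0" by (simp add: g_def chart_inverse)
    qed
  qed
qed

end

text \<open>
  The identity theorem: the interior of the zero set is open and closed.
\<close>

lemma flat_imp_zero:
  assumes conn: "connected (UNIV :: 'a set)" and h: "h \<in> holomorphic_functions \<A>"
    and chart: "(U, \<phi>) \<in> \<A>" and q: "q \<in> U" and flat: "\<And>m. vanishes_to_order \<phi> q m h"
  shows "h x = 0"
proof -
  define Z where "Z = interior {x. h x = 0}"
  have in_Z: "N \<subseteq> Z" if "open N" "\<forall>x\<in>N. h x = 0" for N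
    unfolding Z_def using that by (intro interior_maximal) auto
  obtain N where "open N" "q \<in> N" "\<forall>x\<in>N. h x = 0"
    by (rule flat_imp_locally_zero[OF chart q h]) (use flat in blast)
  then have "q \<in> Z" using in_Z by blast
  have "closure Z \<subseteq> Z"
  proof
    fix x assume x: "x \<in> closure Z"
    obtain W \<psi> where W: "(W, \<psi>) \<in> \<A>" "x \<in> W" using chart_at by blast
    obtain N where N: "open N" "x \<in> N"
      "\<forall>y\<in>N. (\<forall>m. vanishes_to_order \<psi> y m h) \<longrightarrow> (\<forall>x\<in>N. h x = 0)"
      by (rule flat_imp_locally_zero[OF W h], rule that)
    obtain y where y: "y \<in> N" "y \<in> Z" using x N(1,2) unfolding closure_iff_nhds_not_empty by blast
    have "\<forall>\<^sub>F x in nhds y. x \<in> Z" using y(2) by (intro eventually_nhds_in_open) (auto simp: Z_def)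
    then have "\<forall>\<^sub>F x in nhds y. norm (h x) \<le> 0 * norm (\<psi> x - \<psi> y) ^ m" for m
      by (rule eventually_mono) (use interior_subset in \<open>auto simp: Z_def\<close>)
    then have "\<And>m. vanishes_to_order \<psi> y m h" unfolding vanishes_to_order_def by blast
    then have "\<forall>x\<in>N. h x = 0" using bspec[OF N(3) y(1)] by simp
    then show "x \<in> Z" using in_Z N(1,2) by blast
  qed
  then have "closed Z" using closure_subset_eq by blast
  moreover have "open Z" by (simp add: Z_def)
  ultimately have "Z = UNIV"
    using conn \<open>q \<in> Z\<close> unfolding connected_clopen by (auto simp: closed_closedin[symmetric])
  then show ?thesis using interior_subset[of "{x. h x = 0}"] by (auto simp: Z_def)
qed

text \<open>
  Differentiability of \<open>f\<close> in charts makes it Lipschitz at the point \<open>q\<close>, and \<open>u\<close> is bounded near \<open>q\<close>;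
  no chain rule for higher derivatives is involved.
\<close>

lemma vanishes_to_order_weighted_comp:
  assumes f: "holomorphic_self_map \<A> f" and u: "u \<in> holomorphic_functions \<A>"
    and U: "(U, \<phi>) \<in> \<A>" "q \<in> U" and W: "(W, \<psi>) \<in> \<A>" "f q \<in> W"
    and h: "vanishes_to_order \<psi> (f q) m h"
  shows "vanishes_to_order \<phi> q m (weighted_comp u f h)"
proof -
  have contf: "continuous_on UNIV f" using f by (simp add: holomorphic_self_map_def)
  have ev_f: "\<forall>\<^sub>F x in nhds q. f x \<in> S" if "open S" "f q \<in> S" for S
  proof -
    have "open (f -` S)" by (rule open_vimage[OF that(1) contf])
    from eventually_nhds_in_open[OF this, of q] show ?thesis using that(2) by simp
  qed
  have lip: "\<exists>L\<ge>0. \<forall>\<^sub>F x in nhds q. norm ((\<psi> (f x) - \<psi> (f q)) $ i) \<le> L * norm (\<phi> x - \<phi> q)" for i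
  proof -
    define G where "G z = \<psi> (f (inv_into U \<phi> z)) $ i" for z
    have "mv_holomorphic_on G (\<phi> ` (U \<inter> f -` W))"
      using f U(1) W(1) unfolding holomorphic_self_map_def G_def by blast
    then obtain G' where G': "(G has_derivative G') (at (\<phi> q) within \<phi> ` (U \<inter> f -` W))"
      using U(2) W(2) unfolding mv_holomorphic_on_def by blast
    then obtain \<delta> where \<delta>: "0 < \<delta>" "\<And>z. z \<in> \<phi> ` (U \<inter> f -` W) \<Longrightarrow> norm (z - \<phi> q) < \<delta> \<Longrightarrow>
        norm (G z - G (\<phi> q) - G' (z - \<phi> q)) \<le> 1 * norm (z - \<phi> q)"
      unfolding has_derivative_within_alt by (meson zero_less_one)
    obtain K where K: "0 \<le> K" "\<And>v. norm (G' v) \<le> norm v * K"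
      using bounded_linear.nonneg_bounded[OF has_derivative_bounded_linear[OF G']] by blast
    have "\<forall>\<^sub>F x in nhds q. x \<in> U \<and> \<phi> x \<in> ball (\<phi> q) \<delta>"
      using \<delta>(1) by (intro eventually_in_chart[OF U]) auto
    moreover have "\<forall>\<^sub>F x in nhds q. f x \<in> W" using chart_facts(1)[OF W(1)] W(2) by (rule ev_f)
    ultimately have "\<forall>\<^sub>F x in nhds q. norm ((\<psi> (f x) - \<psi> (f q)) $ i) \<le> (1 + K) * norm (\<phi> x - \<phi> q)"
    proof eventually_elim
      case (elim x)
      have "norm (G (\<phi> x) - G (\<phi> q) - G' (\<phi> x - \<phi> q)) \<le> 1 * norm (\<phi> x - \<phi> q)"
        using elim by (intro \<delta>(2)) (auto simp: dist_norm norm_minus_commute)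
      moreover have "norm (G' (\<phi> x - \<phi> q)) \<le> norm (\<phi> x - \<phi> q) * K" by (rule K(2))
      ultimately have "norm (G (\<phi> x) - G (\<phi> q)) \<le> (1 + K) * norm (\<phi> x - \<phi> q)"
        using norm_triangle_sub[of "G (\<phi> x) - G (\<phi> q)" "G' (\<phi> x - \<phi> q)"] by (simp add: algebra_simps)
      then show ?case using elim U chart_inverse[OF U(1)] by (simp add: G_def)
    qed
    then show ?thesis using K(1) by (intro exI[of _ "1 + K"]) auto
  qed
  have all_lip: "\<forall>i. \<exists>L\<ge>0. \<forall>\<^sub>F x in nhds q. norm ((\<psi> (f x) - \<psi> (f q)) $ i) \<le> L * norm (\<phi> x - \<phi> q)"
    by (intro allI lip)
  obtain L where L: "\<forall>i. 0 \<le> L i \<and>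
      (\<forall>\<^sub>F x in nhds q. norm ((\<psi> (f x) - \<psi> (f q)) $ i) \<le> L i * norm (\<phi> x - \<phi> q))"
    using choice[OF all_lip] by (elim exE) (rule that)
  define L' where "L' = (\<Sum>i\<in>UNIV. L i)"
  have "\<forall>\<^sub>F x in nhds q. \<forall>i. norm ((\<psi> (f x) - \<psi> (f q)) $ i) \<le> L i * norm (\<phi> x - \<phi> q)"
    by (intro eventually_all_finite allI) (use L in blast)
  then have lipschitz: "\<forall>\<^sub>F x in nhds q. norm (\<psi> (f x) - \<psi> (f q)) \<le> L' * norm (\<phi> x - \<phi> q)"
  proof (rule eventually_mono)
    fix x assume "\<forall>i. norm ((\<psi> (f x) - \<psi> (f q)) $ i) \<le> L i * norm (\<phi> x - \<phi> q)"
    then have "(\<Sum>i\<in>UNIV. norm ((\<psi> (f x) - \<psi> (f q)) $ i)) \<le> L' * norm (\<phi> x - \<phi> q)"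
      unfolding L'_def sum_distrib_right by (intro sum_mono) blast
    then show "norm (\<psi> (f x) - \<psi> (f q)) \<le> L' * norm (\<phi> x - \<phi> q)"
      by (rule order_trans[OF norm_le_sum_components])
  qed
  have bounded: "\<forall>\<^sub>F x in nhds q. norm (u x) < norm (u q) + 1"
  proof -
    have "open (U \<inter> u -` ball 0 (norm (u q) + 1))"
      by (rule continuous_open_preimage[OF holomorphic_imp_continuous_on_chart[OF U(1) u]
            chart_facts(1)[OF U(1)] open_ball])
    then have "\<forall>\<^sub>F x in nhds q. x \<in> U \<inter> u -` ball 0 (norm (u q) + 1)"
      by (rule eventually_nhds_in_open) (use U(2) in simp)
    then show ?thesis by (rule eventually_mono) simp
  qed
  obtain C S where S: "open S" "f q \<in> S" "\<And>y. y \<in> S \<Longrightarrow> norm (h y) \<le> C * norm (\<psi> y - \<psi> (f q)) ^ m"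
    using h unfolding vanishes_to_order_def eventually_nhds by blast
  have "\<forall>\<^sub>F x in nhds q. norm (weighted_comp u f h x) \<le>
      ((norm (u q) + 1) * (\<bar>C\<bar> * L' ^ m)) * norm (\<phi> x - \<phi> q) ^ m"
    using lipschitz bounded ev_f[OF S(1,2)]
  proof eventually_elim
    case (elim x)
    have "norm (h (f x)) \<le> C * norm (\<psi> (f x) - \<psi> (f q)) ^ m" by (rule S(3)[OF elim(3)])
    also have "\<dots> \<le> \<bar>C\<bar> * (L' * norm (\<phi> x - \<phi> q)) ^ m"
      using elim(1) by (intro mult_mono power_mono) auto
    finally have "norm (u x) * norm (h (f x)) \<le> (norm (u q) + 1) * (\<bar>C\<bar> * (L' * norm (\<phi> x - \<phi> q)) ^ m)"
      using elim(2) by (intro mult_mono) auto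
    then show ?case by (simp add: weighted_comp_def norm_mult power_mult_distrib mult_ac)
  qed
  then show ?thesis unfolding vanishes_to_order_def by blast
qed

lemma vanishes_to_order_antimono:
  assumes chart: "(U, \<phi>) \<in> \<A>" "q \<in> U" and h: "vanishes_to_order \<phi> q m h" and le: "k \<le> m"
  shows "vanishes_to_order \<phi> q k h"
proof -
  obtain C where C: "\<forall>\<^sub>F x in nhds q. norm (h x) \<le> C * norm (\<phi> x - \<phi> q) ^ m"
    using h unfolding vanishes_to_order_def by blast
  have "\<forall>\<^sub>F x in nhds q. x \<in> U \<and> \<phi> x \<in> ball (\<phi> q) 1"
    by (intro eventually_in_chart[OF chart]) auto
  with C have "\<forall>\<^sub>F x in nhds q. norm (h x) \<le> \<bar>C\<bar> * norm (\<phi> x - \<phi> q) ^ k"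
  proof eventually_elim
    case (elim x)
    have "C * norm (\<phi> x - \<phi> q) ^ m \<le> \<bar>C\<bar> * norm (\<phi> x - \<phi> q) ^ k"
      using elim(2) le by (intro mult_mono power_decreasing) (auto simp: dist_norm norm_minus_commute)
    with elim(1) show ?case by simp
  qed
  then show ?thesis unfolding vanishes_to_order_def by blast
qed

end

lemma subspace_vanishes_to_order: "fun_vs.subspace {h. vanishes_to_order \<phi> q m h}"
proof (rule fun_vs.subspaceI)
  show "0 \<in> {h. vanishes_to_order \<phi> q m h}"
    by (auto simp: vanishes_to_order_def intro!: exI[of _ 0])
  show "g + h \<in> {h. vanishes_to_order \<phi> q m h}"
    if gh: "g \<in> {h. vanishes_to_order \<phi> q m h}" "h \<in> {h. vanishes_to_order \<phi> q m h}" for g h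
  proof -
    obtain C D where CD: "\<forall>\<^sub>F x in nhds q. norm (g x) \<le> C * norm (\<phi> x - \<phi> q) ^ m"
      "\<forall>\<^sub>F x in nhds q. norm (h x) \<le> D * norm (\<phi> x - \<phi> q) ^ m"
      using gh unfolding vanishes_to_order_def by blast
    then have "\<forall>\<^sub>F x in nhds q. norm ((g + h) x) \<le> (C + D) * norm (\<phi> x - \<phi> q) ^ m"
      by eventually_elim (use norm_triangle_mono in \<open>auto simp: distrib_right\<close>)
    then show ?thesis unfolding vanishes_to_order_def by blast
  qed
  show "scale_fun c h \<in> {h. vanishes_to_order \<phi> q m h}"
    if h: "h \<in> {h. vanishes_to_order \<phi> q m h}" for c h
  proof -
    obtain C where "\<forall>\<^sub>F x in nhds q. norm (h x) \<le> C * norm (\<phi> x - \<phi> q) ^ m"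
      using h unfolding vanishes_to_order_def by blast
    then have "\<forall>\<^sub>F x in nhds q. norm (scale_fun c h x) \<le> (norm c * C) * norm (\<phi> x - \<phi> q) ^ m"
      by eventually_elim (simp add: scale_fun_def norm_mult mult_left_mono mult.assoc)
    then show ?thesis unfolding vanishes_to_order_def by blast
  qed
qed

section \<open>Density in the function space\<close>

lemma finite_functionals_uniform_control:
  assumes "finite \<Phi>" "\<forall>l\<in>\<Phi>. compactly_bounded_functional V l" "0 < (\<epsilon>::real)"
  shows "\<exists>K \<delta>. compact K \<and> 0 < \<delta> \<and>
    (\<forall>l\<in>\<Phi>. \<forall>h\<in>V. (\<forall>x\<in>K. norm (h x) < \<delta>) \<longrightarrow> norm (l h) < \<epsilon>)"
  using assms(1,2)
proof (induction \<Phi> rule: finite_induct)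
  case empty
  show ?case by (intro exI[of _ "{}"] exI[of _ 1]) simp
next
  case (insert l \<Phi>)
  have "\<exists>K \<delta>. compact K \<and> 0 < \<delta> \<and>
      (\<forall>l\<in>\<Phi>. \<forall>h\<in>V. (\<forall>x\<in>K. norm (h x) < \<delta>) \<longrightarrow> norm (l h) < \<epsilon>)"
    by (rule insert.IH) (use insert.prems in simp)
  then obtain K \<delta> where K: "compact K" "0 < \<delta>"
    "\<And>k h. k \<in> \<Phi> \<Longrightarrow> h \<in> V \<Longrightarrow> (\<forall>x\<in>K. norm (h x) < \<delta>) \<Longrightarrow> norm (k h) < \<epsilon>"
    by blast
  have l: "compactly_bounded_functional V l" using insert.prems by simp
  obtain L B where L: "compact L" "0 \<le> B"
    "\<And>h M. h \<in> V \<Longrightarrow> (\<forall>x\<in>L. norm (h x) \<le> M) \<Longrightarrow> norm (l h) \<le> B * M"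
    using l[unfolded compactly_bounded_functional_def, THEN conjunct2, THEN conjunct2] by blast
  define \<eta> where "\<eta> = \<epsilon> / (B + 1)"
  have \<eta>: "0 < \<eta>" "B * \<eta> < \<epsilon>" using L(2) assms(3) by (simp_all add: \<eta>_def field_simps)
  show ?case
  proof (intro exI[of _ "K \<union> L"] exI[of _ "min \<delta> \<eta>"] conjI ballI impI)
    show "compact (K \<union> L)" "0 < min \<delta> \<eta>" using K(1,2) L(1) \<eta>(1) by auto
    fix k h assume k: "k \<in> insert l \<Phi>" and h: "h \<in> V" "\<forall>x\<in>K \<union> L. norm (h x) < min \<delta> \<eta>"
    show "norm (k h) < \<epsilon>"
    proof (cases "k = l")
      case True
      have "norm (l h) \<le> B * \<eta>" using h by (intro L(3)) (auto intro: less_imp_le)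
      then show ?thesis using True \<eta>(2) by simp
    next
      case False
      then show ?thesis using k h by (intro K(3)) auto
    qed
  qed
qed

text \<open>
  The topology of \<open>V\<close> is finer than that of uniform convergence on compact sets, so a dense set can be
  approximated with respect to finitely many compactly bounded functionals at once.
\<close>

lemma dense_in_imp_weakly_dense:
  fixes T :: "('a::topological_space \<Rightarrow> complex) topology" and \<A> :: "('a, 'n::finite) chart set"
  assumes sub: "fun_vs.subspace (topspace T)" and hol: "topspace T \<subseteq> holomorphic_functions \<A>"
    and cont: "continuous_map T (compact_convergence_topology \<A>) (\<lambda>h. h)"
    and dense: "dense_in T S"
    and \<Phi>: "finite \<Phi>" "\<And>l. l \<in> \<Phi> \<Longrightarrow> compactly_bounded_functional (topspace T) l"
    and v: "v \<in> topspace T" and \<epsilon>: "0 < (\<epsilon>::real)"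
  obtains a where "a \<in> S" "\<And>l. l \<in> \<Phi> \<Longrightarrow> norm (l a - l v) < \<epsilon>"
proof -
  have "\<forall>l\<in>\<Phi>. compactly_bounded_functional (topspace T) l" using \<Phi>(2) by blast
  from finite_functionals_uniform_control[OF \<Phi>(1) this \<epsilon>]
  obtain K \<delta> where K: "compact K" "0 < \<delta>" "\<And>l h. l \<in> \<Phi> \<Longrightarrow> h \<in> topspace T \<Longrightarrow>
      (\<forall>x\<in>K. norm (h x) < \<delta>) \<Longrightarrow> norm (l h) < \<epsilon>" by blast
  define N where "N = {g \<in> holomorphic_functions \<A>. \<forall>x\<in>K. dist (g x) (v x) < \<delta>}"
  have "openin (compact_convergence_topology \<A>) N"
    unfolding compact_convergence_topology_def
    by (rule topology_generated_by_Basis) (use v hol K in \<open>auto simp: N_def\<close>)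
  from openin_continuous_map_preimage[OF cont this]
  have "openin T {h \<in> topspace T. h \<in> N}" .
  moreover have "v \<in> {h \<in> topspace T. h \<in> N}" using v hol K(2) by (auto simp: N_def)
  moreover have "v \<in> T closure_of S" using dense v by (simp add: dense_in_def)
  ultimately have "\<exists>a. a \<in> S \<and> a \<in> {h \<in> topspace T. h \<in> N}"
    unfolding in_closure_of by metis
  then obtain a where a: "a \<in> S" "a \<in> topspace T" "a \<in> N" by auto
  have "norm (l a - l v) < \<epsilon>" if l: "l \<in> \<Phi>" for l
  proof -
    note add = \<Phi>(2)[OF l, unfolded compactly_bounded_functional_def, THEN conjunct1, rule_format]
    note scale = \<Phi>(2)[OF l, unfolded compactly_bounded_functional_def, THEN conjunct2, THEN conjunct1, rule_format]
    have neg: "scale_fun (- 1) v \<in> topspace T" by (rule fun_vs.subspace_scale[OF sub v])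
    then have diff: "a + scale_fun (- 1) v \<in> topspace T" by (rule fun_vs.subspace_add[OF sub a(2)])
    have "norm (l (a + scale_fun (- 1) v)) < \<epsilon>"
      by (rule K(3)[OF l diff]) (use a(3) in \<open>auto simp: N_def dist_norm scale_fun_def\<close>)
    also have "l (a + scale_fun (- 1) v) = l a + l (scale_fun (- 1) v)"
      using add[OF a(2) neg] by (simp add: plus_fun_def)
    also have "l (scale_fun (- 1) v) = - l v"
      using scale[OF v, of "- 1"] by (simp add: scale_fun_def)
    finally show ?thesis by simp
  qed
  then show thesis using that a(1) by blast
qed

text \<open>
  Once \<open>x\<close> is not in \<open>W m\<close>, the coefficient \<open>c\<close> is unique and hence the same for all larger \<open>m\<close>.
\<close>

lemma (in vector_space) line_modulo_nested_subspaces: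
  fixes W :: "nat \<Rightarrow> 'b set"
  assumes sub: "\<And>m. subspace (W m)" and mono: "\<And>k m. k \<le> m \<Longrightarrow> W m \<subseteq> W k"
    and ex: "\<And>m. \<exists>c. v - scale c x \<in> W m"
  shows "\<exists>c. \<forall>m. v - scale c x \<in> W m"
proof (cases "\<forall>m. x \<in> W m")
  case True
  have "v - scale 0 x \<in> W m" for m
  proof -
    obtain c where "v - scale c x \<in> W m" using ex by blast
    moreover have "scale c x \<in> W m" using True sub by (intro subspace_scale) auto
    ultimately have "(v - scale c x) + scale c x \<in> W m" using sub by (intro subspace_add)
    then show ?thesis by simp
  qed
  then show ?thesis by blast
next
  case False
  then obtain m0 where m0: "x \<notin> W m0" by blast
  obtain c where c: "\<And>m. v - scale (c m) x \<in> W m" using ex by metis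
  have eq: "c m = c m0" if "m0 \<le> m" for m
  proof (rule ccontr)
    assume ne: "c m \<noteq> c m0"
    have "v - scale (c m) x \<in> W m0" using c[of m] mono[OF that] by blast
    then have "(v - scale (c m0) x) - (v - scale (c m) x) \<in> W m0"
      by (rule subspace_diff[OF sub c])
    then have "scale (c m - c m0) x \<in> W m0" by (simp add: scale_left_diff_distrib)
    then have "scale (1 / (c m - c m0)) (scale (c m - c m0) x) \<in> W m0"
      by (rule subspace_scale[OF sub])
    then show False using ne m0 by simp
  qed
  have "v - scale (c m0) x \<in> W m" for m
  proof -
    have "v - scale (c (max m m0)) x \<in> W (max m m0)" by (rule c)
    then have "v - scale (c (max m m0)) x \<in> W m" using mono[of m "max m m0"] by auto
    then show ?thesis using eq[of "max m m0"] by simp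
  qed
  then show ?thesis by blast
qed

section \<open>Weighted composition operators and periodic points\<close>

lemma linear_weighted_comp: "Vector_Spaces.linear scale_fun scale_fun (weighted_comp u f)"
  unfolding Vector_Spaces.linear_iff
  by (auto simp: fun_vs.vector_space_axioms weighted_comp_def scale_fun_def fun_eq_iff algebra_simps)

lemma finite_forward_orbit:
  assumes "(f ^^ r) p = p" "1 \<le> r"
  shows "finite (range (\<lambda>k. (f ^^ k) p))"
proof (rule finite_subset)
  show "range (\<lambda>k. (f ^^ k) p) \<subseteq> (\<lambda>k. (f ^^ k) p) ` {..<r}"
  proof
    fix y assume "y \<in> range (\<lambda>k. (f ^^ k) p)"
    then obtain k where "y = (f ^^ k) p" by blast
    then have "y = (f ^^ (k mod r)) p" using funpow_mod_eq[OF assms(1), of k] by simp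
    moreover have "k mod r < r" using assms(2) by simp
    ultimately show "y \<in> (\<lambda>k. (f ^^ k) p) ` {..<r}" by blast
  qed
qed simp

theorem theorem1p5:
  fixes E :: "(complex ^ 'n) set"
    and \<A> :: "('a :: {t2_space, second_countable_topology}, 'n) chart set"
    and f :: "'a \<Rightarrow> 'a"
    and u :: "'a \<Rightarrow> complex"
    and V :: "('a \<Rightarrow> complex) set"
    and T :: "('a \<Rightarrow> complex) topology"
  assumes "complex_manifold E \<A>"
    and "connected (UNIV :: 'a set)"
    and "holomorphic_self_map \<A> f"
    and "u \<in> holomorphic_functions \<A>"
    and "topspace T = V"
    and "function_tvs T"
    and "V \<subseteq> holomorphic_functions \<A>"
    and "continuous_map T (compact_convergence_topology \<A>) (\<lambda>h. h)"
    and "supercyclic scale_fun T (weighted_comp_domain u f V) (weighted_comp u f) \<and> dim_at_least 2 V \<or>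
         hypercyclic T (weighted_comp_domain u f V) (weighted_comp u f) \<and> dim_at_least 1 V"
  shows "\<not> (\<exists>p. periodic_point f p)"
proof
  assume "\<exists>p. periodic_point f p"
  then obtain p r where r: "1 \<le> r" "(f ^^ r) p = p" unfolding periodic_point_def by blast
  \<comment> \<open>The whole cycle through \<open>p\<close> is used: at \<open>p\<close> alone only the \<open>r\<close>-th power of the operator
    is certain to preserve the order of vanishing.\<close>
  define Q where "Q = range (\<lambda>k. (f ^^ k) p)"
  have finQ: "finite Q" unfolding Q_def by (rule finite_forward_orbit[OF r(2,1)])
  have fQ: "f q \<in> Q" if "q \<in> Q" for q
  proof -
    obtain k where "q = (f ^^ k) p" using \<open>q \<in> Q\<close> by (auto simp: Q_def)
    then have "f q = (f ^^ Suc k) p" by simp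
    then show ?thesis unfolding Q_def by blast
  qed
  have pQ: "p \<in> Q" unfolding Q_def by (rule range_eqI[of _ _ 0]) simp
  have "\<exists>c. c \<in> \<A> \<and> q \<in> fst c" for q
    using chart_at[OF assms(1), of q] by (metis fst_conv)
  then obtain chart where chart: "\<And>q. chart q \<in> \<A>" "\<And>q. q \<in> fst (chart q)" by metis
  define dom where "dom q = fst (chart q)" for q
  define \<phi> where "\<phi> q = snd (chart q)" for q
  have chart': "(dom q, \<phi> q) \<in> \<A>" "q \<in> dom q" for q
    using chart[of q] by (simp_all add: dom_def \<phi>_def)
  define W where "W m = (\<Inter>q\<in>Q. {h. vanishes_to_order (\<phi> q) q m h})" for m
  have subV: "fun_vs.subspace V" using assms(5,6) by (simp add: function_tvs_def)
  have subW: "fun_vs.subspace (W m)" for m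
    unfolding W_def by (intro fun_vs.subspace_Int subspace_vanishes_to_order)
  have invW: "weighted_comp u f ` W m \<subseteq> W m" for m
  proof (intro image_subsetI)
    fix h assume h: "h \<in> W m"
    have "vanishes_to_order (\<phi> q) q m (weighted_comp u f h)" if "q \<in> Q" for q
      by (rule vanishes_to_order_weighted_comp[OF assms(1,3,4) chart' chart'])
        (use h fQ[OF that] in \<open>simp add: W_def\<close>)
    then show "weighted_comp u f h \<in> W m" by (simp add: W_def)
  qed
  have decW: "W m \<subseteq> W k" if "k \<le> m" for k m
    unfolding W_def using vanishes_to_order_antimono[OF assms(1) chart' _ that] by blast
  have flat: "h = 0" if h: "h \<in> V" "\<And>m. h \<in> W m" for h
  proof
    fix x
    have "vanishes_to_order (\<phi> p) p m h" for m using h(2)[of m] pQ by (simp add: W_def)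
    from flat_imp_zero[OF assms(1,2) _ chart' this] show "h x = 0 x"
      using h(1) assms(7) by (simp add: subsetD)
  qed
  have functionals: "\<exists>\<Phi>. finite \<Phi> \<and> (\<forall>l\<in>\<Phi>. compactly_bounded_functional V l) \<and>
      (\<forall>h\<in>V. (\<forall>l\<in>\<Phi>. l h = 0) \<longrightarrow> h \<in> W m)" for m
  proof -
    have "\<exists>\<Phi>. finite \<Phi> \<and> (\<forall>l\<in>\<Phi>. compactly_bounded_functional V l) \<and>
      (\<forall>h\<in>V. (\<forall>l\<in>\<Phi>. l h = 0) \<longrightarrow> vanishes_to_order (\<phi> q) q m h)" for q
    proof (rule vanishing_order_finitely_determined[OF assms(1) chart'])
      fix \<Phi> assume \<Phi>: "finite \<Phi>"
        "\<And>l. l \<in> \<Phi> \<Longrightarrow> compactly_bounded_functional (holomorphic_functions \<A>) l"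
        "\<And>h. h \<in> holomorphic_functions \<A> \<Longrightarrow> (\<And>l. l \<in> \<Phi> \<Longrightarrow> l h = 0) \<Longrightarrow> vanishes_to_order (\<phi> q) q m h"
      show ?thesis
        using \<Phi>(1) compactly_bounded_functional_subset[OF \<Phi>(2) assms(7)] \<Phi>(3)[OF subsetD[OF assms(7)]]
        by (intro exI[of _ \<Phi>] conjI ballI impI) simp_all
    qed
    then have "\<forall>q. \<exists>\<Phi>. finite \<Phi> \<and> (\<forall>l\<in>\<Phi>. compactly_bounded_functional V l) \<and>
      (\<forall>h\<in>V. (\<forall>l\<in>\<Phi>. l h = 0) \<longrightarrow> vanishes_to_order (\<phi> q) q m h)" by (intro allI)
    from choice[OF this] obtain \<Phi> where \<Phi>: "\<forall>q. finite (\<Phi> q) \<and>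
      (\<forall>l\<in>\<Phi> q. compactly_bounded_functional V l) \<and>
      (\<forall>h\<in>V. (\<forall>l\<in>\<Phi> q. l h = 0) \<longrightarrow> vanishes_to_order (\<phi> q) q m h)" by (elim exE) (rule that)
    show ?thesis
    proof (intro exI[of _ "\<Union>q\<in>Q. \<Phi> q"] conjI ballI impI)
      show "finite (\<Union>q\<in>Q. \<Phi> q)" using finQ \<Phi> by simp
      show "compactly_bounded_functional V l" if "l \<in> (\<Union>q\<in>Q. \<Phi> q)" for l using that \<Phi> by auto
      show "h \<in> W m" if "h \<in> V" "\<forall>l\<in>(\<Union>q\<in>Q. \<Phi> q). l h = 0" for h
        using that \<Phi> by (simp add: W_def)
    qed
  qed
  have orbit: "(weighted_comp u f ^^ n) x \<in> V"
    if "x \<in> (\<Inter>n. power_domain T (weighted_comp_domain u f V) (weighted_comp u f) n)" for x n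
  proof -
    \<comment> \<open>The index is shifted: membership in \<open>power_domain\<close> at \<open>Suc n\<close> says that the \<open>n\<close>-th iterate is in the domain.\<close>
    have "x \<in> power_domain T (weighted_comp_domain u f V) (weighted_comp u f) (Suc n)" using that by blast
    then show ?thesis by (simp add: weighted_comp_domain_def)
  qed
  have observed: "observed_orbit scale_fun (weighted_comp u f) x V (W m) \<Phi> (\<lambda>l. l)"
    if x: "\<And>n. (weighted_comp u f ^^ n) x \<in> V" and \<Phi>: "finite \<Phi>"
      "\<forall>l\<in>\<Phi>. compactly_bounded_functional V l" "\<forall>h\<in>V. (\<forall>l\<in>\<Phi>. l h = 0) \<longrightarrow> h \<in> W m" for x m \<Phi>
  proof (intro observed_orbit.intro observed_orbit_axioms.intro linear_weighted_comp subV subW invW x \<Phi>(1))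
    fix l :: "('a \<Rightarrow> complex) \<Rightarrow> complex" and g h c assume l: "l \<in> \<Phi>" and gh: "g \<in> V" "h \<in> V"
    note lb = bspec[OF \<Phi>(2) l, unfolded compactly_bounded_functional_def]
    show "l (g + h) = l g + l h"
      using lb[THEN conjunct1, rule_format, OF gh] by (simp add: plus_fun_def)
  next
    fix l :: "('a \<Rightarrow> complex) \<Rightarrow> complex" and h c assume l: "l \<in> \<Phi>" and h: "h \<in> V"
    note lb = bspec[OF \<Phi>(2) l, unfolded compactly_bounded_functional_def]
    show "l (scale_fun c h) = c * l h"
      using lb[THEN conjunct2, THEN conjunct1, rule_format, OF h] by (simp add: scale_fun_def)
  next
    show "h \<in> W m" if "h \<in> V" "\<And>l. l \<in> \<Phi> \<Longrightarrow> l h = 0" for h using \<Phi>(3) that by blast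
  qed
  note weakly_dense = dense_in_imp_weakly_dense[of T \<A>, unfolded assms(5), OF subV assms(7,8)]
  from assms(9) show False
  proof
    assume "hypercyclic T (weighted_comp_domain u f V) (weighted_comp u f) \<and> dim_at_least 1 V"
    then obtain x B where x: "\<And>n. (weighted_comp u f ^^ n) x \<in> V"
        "dense_in T {(weighted_comp u f ^^ n) x |n. True}"
      and B: "B \<subseteq> V" "fun_vs.independent B" "card B = 1"
      unfolding hypercyclic_def dim_at_least_def using orbit by blast
    have "V \<subseteq> W m" for m
    proof -
      obtain \<Phi> where \<Phi>: "finite \<Phi>" "\<forall>l\<in>\<Phi>. compactly_bounded_functional V l"
        "\<forall>h\<in>V. (\<forall>l\<in>\<Phi>. l h = 0) \<longrightarrow> h \<in> W m" using functionals[of m] by (elim exE conjE) (rule that)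
      show ?thesis
      proof (rule observed_orbit.weakly_hypercyclic_imp_subset[OF observed[OF x(1) \<Phi>]])
        fix v \<epsilon> assume v: "v \<in> V" and \<epsilon>: "0 < (\<epsilon>::real)"
        obtain a where "a \<in> {(weighted_comp u f ^^ n) x |n. True}" "\<And>l. l \<in> \<Phi> \<Longrightarrow> norm (l a - l v) < \<epsilon>"
          by (rule weakly_dense[OF x(2) \<Phi>(1) bspec[OF \<Phi>(2)] v \<epsilon>], assumption, rule that)
        then show "\<exists>n. \<forall>l\<in>\<Phi>. norm (l ((weighted_comp u f ^^ n) x) - l v) < \<epsilon>" by blast
      qed
    qed
    then have "V \<subseteq> {0}" using flat by blast
    moreover obtain b where "B = {b}" using B(3) by (auto simp: card_1_singleton_iff)
    ultimately have "0 \<in> B" using B(1) by blast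
    then show False using B(2) fun_vs.dependent_zero by blast
  next
    assume "supercyclic scale_fun T (weighted_comp_domain u f V) (weighted_comp u f) \<and> dim_at_least 2 V"
    then obtain x B where x: "\<And>n. (weighted_comp u f ^^ n) x \<in> V"
        "dense_in T {scale_fun c ((weighted_comp u f ^^ n) x) |c n. True}"
      and B: "B \<subseteq> V" "fun_vs.independent B" "card B = 2"
      unfolding supercyclic_def dim_at_least_def using orbit by blast
    have mod_W: "\<exists>c. v - scale_fun c x \<in> W m" if v: "v \<in> V" for v m
    proof -
      obtain \<Phi> where \<Phi>: "finite \<Phi>" "\<forall>l\<in>\<Phi>. compactly_bounded_functional V l"
        "\<forall>h\<in>V. (\<forall>l\<in>\<Phi>. l h = 0) \<longrightarrow> h \<in> W m" using functionals[of m] by (elim exE conjE) (rule that)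
      show ?thesis
      proof (rule observed_orbit.weakly_supercyclic_imp_subset[OF observed[OF x(1) \<Phi>] _ v])
        fix v \<epsilon> assume v: "v \<in> V" and \<epsilon>: "0 < (\<epsilon>::real)"
        obtain a where "a \<in> {scale_fun c ((weighted_comp u f ^^ n) x) |c n. True}"
            "\<And>l. l \<in> \<Phi> \<Longrightarrow> norm (l a - l v) < \<epsilon>"
          by (rule weakly_dense[OF x(2) \<Phi>(1) bspec[OF \<Phi>(2)] v \<epsilon>], assumption, rule that)
        then show "\<exists>c n. \<forall>l\<in>\<Phi>. norm (l (scale_fun c ((weighted_comp u f ^^ n) x)) - l v) < \<epsilon>" by blast
      qed
    qed
    have "B \<subseteq> fun_vs.span {x}"
    proof
      fix v assume "v \<in> B"
      then have v: "v \<in> V" using B(1) by blast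
      have "\<exists>c. \<forall>m. v - scale_fun c x \<in> W m"
        by (rule fun_vs.line_modulo_nested_subspaces) (rule subW, erule decW, rule mod_W[OF v])
      then obtain c where c: "\<forall>m. v - scale_fun c x \<in> W m" by blast
      have "x \<in> V" using x(1)[of 0] by simp
      then have "v - scale_fun c x \<in> V"
        by (intro fun_vs.subspace_diff[OF subV v] fun_vs.subspace_scale[OF subV])
      then have "v - scale_fun c x = 0" using flat c by blast
      then have "v = scale_fun c x" by simp
      then show "v \<in> fun_vs.span {x}" by (simp add: fun_vs.span_base fun_vs.span_scale)
    qed
    then have "card B \<le> card {x}" using fun_vs.independent_span_bound[of "{x}" B] B(2) by simp
    then show False using B(3) by simp
  qed
qed

end
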